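(* For each of the five Platonic solids $T$ (regular tetrahedron, cube, regular octahedron, regular dodecahedron, regular icosahedron) there exists a layer in $\mathbf{R}^3$ all of whose elements are congruent to $T$ and which is a set with full interlocking.
   Context: A layer is a set of convex polyhedra in $\mathbf{R}^3$ with pairwise disjoint interiors (they may touch along their boundaries) such that (1) all the polyhedra are situated between two fixed parallel planes, and (2) all of them can be produced from a finite subset of them by parallel translations: there is a rank-two lattice of translation vectors parallel to these planes such that the set consists of all the translates, by lattice vectors, of finitely many of its members. In particular the layer is infinite. An element $A$ of the layer can be removed if, with all other elements kept fixed, there is a continuous family of orientation-preserving rigid motions $g_t$, $t\in[0,1]$, of $\mathbf{R}^3$ (arbitrary combinations of translations and rotations) with $g_0=\mathrm{id}$, such that for every $t$ the interior of $g_t(A)$ is disjoint from the interiors of all other elements, and $g_1(A)$ lies outside the open slab between the two parallel planes. The layer is a set with full interlocking if no element of it can be removed. *)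

theory Defs
  imports "HOL-Analysis.Analysis"
begin

subsection \<open>Motions, congruence and similarity\<close>

definition rigid_motion :: "(real^3 \<Rightarrow> real^3) \<Rightarrow> bool" where
  "rigid_motion f \<longleftrightarrow>
     (\<exists>(Q :: real^3^3) c. rotation_matrix Q \<and> f = (\<lambda>x. Q *v x + c))"

definition congruent_sets :: "(real^3) set \<Rightarrow> (real^3) set \<Rightarrow> bool" where
  "congruent_sets S S' \<longleftrightarrow>
     (\<exists>(Q :: real^3^3) c. orthogonal_matrix Q \<and> S' = (\<lambda>x. Q *v x + c) ` S)"

definition similar_sets :: "(real^3) set \<Rightarrow> (real^3) set \<Rightarrow> bool" where
  "similar_sets S S' \<longleftrightarrow>
     (\<exists>r (Q :: real^3^3) c. r > 0 \<and> orthogonal_matrix Q \<and> S' = (\<lambda>x. r *\<^sub>R (Q *v x) + c) ` S)"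

subsection \<open>The Platonic solids\<close>

text \<open>One model of each solid is given by the usual vertex coordinates centred at the origin;
  a Platonic solid is a similar copy of one of the models, of any size and in any position.\<close>

definition golden_ratio :: real where
  "golden_ratio = (1 + sqrt 5) / 2"

definition std_tetrahedron :: "(real^3) set" where
  "std_tetrahedron = convex hull
     {vector [1, 1, 1], vector [1, -1, -1], vector [-1, 1, -1], vector [-1, -1, 1]}"

definition std_cube :: "(real^3) set" where
  "std_cube = convex hull {vector [x, y, z] | x y z. x \<in> {-1, 1} \<and> y \<in> {-1, 1} \<and> z \<in> {-1, 1}}"

definition std_octahedron :: "(real^3) set" where
  "std_octahedron = convex hull
     ({vector [s, 0, 0] | s. s \<in> {-1, 1}} \<union>
      {vector [0, s, 0] | s. s \<in> {-1, 1}} \<union>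
      {vector [0, 0, s] | s. s \<in> {-1, 1}})"

definition std_dodecahedron :: "(real^3) set" where
  "std_dodecahedron = convex hull
     ({vector [x, y, z] | x y z. x \<in> {-1, 1} \<and> y \<in> {-1, 1} \<and> z \<in> {-1, 1}} \<union>
      {vector [0, s * golden_ratio, t / golden_ratio] | s t. s \<in> {-1, 1} \<and> t \<in> {-1, 1}} \<union>
      {vector [t / golden_ratio, 0, s * golden_ratio] | s t. s \<in> {-1, 1} \<and> t \<in> {-1, 1}} \<union>
      {vector [s * golden_ratio, t / golden_ratio, 0] | s t. s \<in> {-1, 1} \<and> t \<in> {-1, 1}})"

definition std_icosahedron :: "(real^3) set" where
  "std_icosahedron = convex hull
     ({vector [0, s, t * golden_ratio] | s t. s \<in> {-1, 1} \<and> t \<in> {-1, 1}} \<union>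
      {vector [t * golden_ratio, 0, s] | s t. s \<in> {-1, 1} \<and> t \<in> {-1, 1}} \<union>
      {vector [s, t * golden_ratio, 0] | s t. s \<in> {-1, 1} \<and> t \<in> {-1, 1}})"

definition platonic_solid :: "(real^3) set \<Rightarrow> bool" where
  "platonic_solid T \<longleftrightarrow>
     (\<exists>P \<in> {std_tetrahedron, std_cube, std_octahedron, std_dodecahedron, std_icosahedron}.
        similar_sets P T)"

subsection \<open>Layers and interlocking\<close>

definition open_slab :: "real^3 \<Rightarrow> real \<Rightarrow> real \<Rightarrow> (real^3) set" where
  "open_slab n a b = {x. a < n \<bullet> x \<and> n \<bullet> x < b}"

definition closed_slab :: "real^3 \<Rightarrow> real \<Rightarrow> real \<Rightarrow> (real^3) set" where
  "closed_slab n a b = {x. a \<le> n \<bullet> x \<and> n \<bullet> x \<le> b}"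

definition lattice2 :: "real^3 \<Rightarrow> real^3 \<Rightarrow> (real^3) set" where
  "lattice2 u v = {of_int i *\<^sub>R u + of_int j *\<^sub>R v | i j. True}"

text \<open>Independence of the set \<open>{u, v}\<close> alone would allow \<open>u = v\<close>, hence the extra condition
  \<open>u \<noteq> v\<close>. Finitely many polyhedra are required to be at least one, so the empty
  family is not a layer.\<close>

definition is_layer :: "real^3 \<Rightarrow> real \<Rightarrow> real \<Rightarrow> (real^3) set set \<Rightarrow> bool" where
  "is_layer n a b L \<longleftrightarrow>
     n \<noteq> 0 \<and> a < b \<and>
     (\<forall>A\<in>L. polytope A \<and> interior A \<noteq> {}) \<and>
     (\<forall>A\<in>L. \<forall>B\<in>L. A \<noteq> B \<longrightarrow> interior A \<inter> interior B = {}) \<and>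
     (\<forall>A\<in>L. A \<subseteq> closed_slab n a b) \<and>
     (\<exists>u v. u \<noteq> v \<and> independent {u, v} \<and> n \<bullet> u = 0 \<and> n \<bullet> v = 0 \<and>
        (\<exists>F. finite F \<and> F \<noteq> {} \<and> F \<subseteq> L \<and>
           L = {(\<lambda>x. w + x) ` A | w A. w \<in> lattice2 u v \<and> A \<in> F}))"

definition removable :: "real^3 \<Rightarrow> real \<Rightarrow> real \<Rightarrow> (real^3) set set \<Rightarrow> (real^3) set \<Rightarrow> bool" where
  "removable n a b L A \<longleftrightarrow>
     (\<exists>g :: real \<Rightarrow> real^3 \<Rightarrow> real^3.
        (\<forall>t\<in>{0..1}. rigid_motion (g t)) \<and>
        continuous_on ({0..1} \<times> UNIV) (\<lambda>(t, x). g t x) \<and>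
        g 0 = id \<and>
        (\<forall>t\<in>{0..1}. \<forall>B\<in>L - {A}. interior (g t ` A) \<inter> interior B = {}) \<and>
        g 1 ` A \<inter> open_slab n a b = {})"

definition full_interlocking :: "real^3 \<Rightarrow> real \<Rightarrow> real \<Rightarrow> (real^3) set set \<Rightarrow> bool" where
  "full_interlocking n a b L \<longleftrightarrow> (\<forall>A\<in>L. \<not> removable n a b L A)"

end

theory Submission
  imports Defs
begin

text \<open>Every element \<open>A\<close> of the layers below touches neighbours along pieces of facets around points
  \<open>m i\<close> with outer normals \<open>n i\<close>, and pushing along \<open>- n i\<close> at \<open>m i\<close> gives a system of forces with
  zero resultant and zero moment whose normals span space. For a motion \<open>x \<mapsto> Q x + c\<close> close to the
  identity, non-penetration gives \<open>n i \<bullet> (Q m i + c - m i) \<le> 0\<close>. By equilibrium these numbers add up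
  to \<open>O(\<theta>\<^sup>2)\<close> with \<open>\<theta> = \<parallel>Q - 1\<parallel>\<close>, so each is \<open>O(\<theta>\<^sup>2)\<close>. Moving the contact point within the facet
  yields \<open>n i \<bullet> (Q - 1) d = O(\<theta>\<^sup>2)\<close> for all directions \<open>d\<close>, hence \<open>\<theta> = O(\<theta>\<^sup>2)\<close>, and so \<open>\<theta> = 0\<close>
  and \<open>c = 0\<close>. Thus \<open>A\<close> cannot move at all.

  The four centrally symmetric solids are placed with a threefold axis vertical: three facet normals
  permuted by the rotation project onto the central horizontal plane as multiples of points
  \<open>\<mu> $ k\<close> of these facets with zero sum, and the translates by the lattice generated by
  \<open>2 *\<^sub>R \<mu> $ k\<close> form the layer.
  For the tetrahedron, whose middle section is a square, copies of \<open>T\<close> and \<open>- T\<close> alternate as on a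
  chessboard.\<close>

section \<open>First-order rigidity\<close>

text \<open>The linear maps with \<open>f x \<bullet> x = 0\<close> are the cross products with a
  fixed vector, so the condition on \<open>f\<close> says that the total moment vanishes. In this
  form it applies directly to a skew map built from a matrix.\<close>

definition balanced :: "'i set \<Rightarrow> ('i \<Rightarrow> real^3) \<Rightarrow> ('i \<Rightarrow> real^3) \<Rightarrow> bool" where
  "balanced I m n \<longleftrightarrow> finite I \<and> (\<Sum>i\<in>I. n i) = 0 \<and>
     (\<forall>f. linear f \<and> (\<forall>x. f x \<bullet> x = 0) \<longrightarrow> (\<Sum>i\<in>I. n i \<bullet> f (m i)) = 0) \<and>
     (\<forall>v. (\<forall>i\<in>I. n i \<bullet> v = 0) \<longrightarrow> v = 0)"

text \<open>\<open>h\<close> is the Gram operator of the normals: \<open>h v \<bullet> v\<close> is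
  the sum of the squares of \<open>n i \<bullet> v\<close>, so spanning makes \<open>h\<close>
  injective, and an injective linear map in finite dimension is bounded below.\<close>

lemma balanced_bounded_below:
  assumes "balanced I m n"
  obtains \<beta> where "\<beta> > 0" "\<And>v. \<beta> * norm v \<le> (\<Sum>i\<in>I. \<bar>n i \<bullet> v\<bar> * norm (n i))"
proof -
  have fin: "finite I" and sp: "\<And>v. (\<forall>i\<in>I. n i \<bullet> v = 0) \<Longrightarrow> v = 0"
    using assms by (auto simp: balanced_def)
  define h where "h v = (\<Sum>i\<in>I. (n i \<bullet> v) *\<^sub>R n i)" for v
  have lin: "linear h"
    unfolding h_def
    by (intro linear_compose_sum linearI ballI)
       (auto simp: inner_add_right scaleR_add_left algebra_simps)
  have "inj h"
  proof (subst linear_injective_0[OF lin], intro allI impI)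
    fix v assume "h v = 0"
    then have "h v \<bullet> v = 0" by simp
    then have "(\<Sum>i\<in>I. (n i \<bullet> v)\<^sup>2) = 0"
      by (simp add: h_def inner_sum_left power2_eq_square)
    then have "\<forall>i\<in>I. n i \<bullet> v = 0"
      by (subst (asm) sum_nonneg_eq_0_iff) (auto simp: fin)
    then show "v = 0" by (rule sp)
  qed
  then obtain \<beta> where \<beta>: "\<beta> > 0" "\<And>v. \<beta> * norm v \<le> norm (h v)"
    using linear_inj_bounded_below_pos[OF lin] by blast
  have hn: "norm (h v) \<le> (\<Sum>i\<in>I. \<bar>n i \<bullet> v\<bar> * norm (n i))" for v
    unfolding h_def by (rule order_trans[OF norm_sum]) simp
  show ?thesis by (rule that[OF \<beta>(1) order_trans[OF \<beta>(2) hn]])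
qed

lemma orthogonal_matrix_inner:
  assumes "orthogonal_matrix (Q :: real^'n^'n)"
  shows "(Q *v x) \<bullet> (Q *v y) = x \<bullet> y"
  using assms orthogonal_transformation_matrix[of "(*v) Q"]
  by (simp add: orthogonal_transformation_def)

text \<open>The column sum serves as the size \<open>\<theta>\<close> of \<open>Q - 1\<close>: it
  dominates the operator norm and involves the images of finitely many points only.\<close>

lemma matrix_vector_norm_columns:
  fixes Q :: "real^'n^'n"
  shows "norm (Q *v x - x) \<le> (\<Sum>j\<in>UNIV. norm (Q *v axis j 1 - axis j 1)) * norm x"
proof -
  have "Q *v x - x = (Q - mat 1) *v x" by (simp add: matrix_vector_mult_diff_rdistrib)
  also have "\<dots> = (\<Sum>j\<in>UNIV. (x $ j) *\<^sub>R ((Q - mat 1) *v axis j 1))"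
    by (metis (no_types, lifting) basis_expansion matrix_vector_mul_linear linear_sum
        matrix_vector_mult_scaleR scalar_mult_eq_scaleR sum.cong)
  also have "norm \<dots> \<le> (\<Sum>j\<in>UNIV. norm x * norm ((Q - mat 1) *v axis j 1))"
    by (rule order_trans[OF norm_sum]) (auto intro!: sum_mono mult_right_mono component_le_norm_cart)
  also have "\<dots> = (\<Sum>j\<in>UNIV. norm (Q *v axis j 1 - axis j 1)) * norm x"
    by (simp add: sum_distrib_left mult.commute[of _ "norm x"] matrix_vector_mult_diff_rdistrib)
  finally show ?thesis .
qed

text \<open>Orthogonality makes \<open>Q - 1\<close> skew up to a quadratic error, and equilibrium
  kills the skew part. \<open>\<delta>\<close> depends only on the contacts and
  \<open>\<epsilon>\<close>; smallness is asked of \<open>Q\<close> and not of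
  \<open>c\<close>.\<close>

lemma balanced_rigid_near_identity:
  fixes m n :: "'i \<Rightarrow> real^3"
  assumes bal: "balanced I m n" and "\<epsilon> > 0"
  obtains \<delta> where "\<delta> > 0"
    "\<And>Q c. \<lbrakk>orthogonal_matrix Q; (\<Sum>j\<in>UNIV. norm (Q *v axis j 1 - axis j 1)) < \<delta>;
        \<And>i d. \<lbrakk>i \<in> I; norm d < \<epsilon>; n i \<bullet> d = 0\<rbrakk> \<Longrightarrow> n i \<bullet> (Q *v (m i + d) + c) \<le> n i \<bullet> m i\<rbrakk>
      \<Longrightarrow> Q = mat 1 \<and> c = 0"
proof -
  have fin: "finite I" and n0: "(\<Sum>i\<in>I. n i) = 0"
    and tor: "\<And>f. linear f \<Longrightarrow> (\<And>x. f x \<bullet> x = 0) \<Longrightarrow> (\<Sum>i\<in>I. n i \<bullet> f (m i)) = 0"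
    and sp: "\<And>v. (\<forall>i\<in>I. n i \<bullet> v = 0) \<Longrightarrow> v = 0"
    using bal by (auto simp: balanced_def)
  obtain \<beta> where \<beta>: "\<beta> > 0" "\<And>v. \<beta> * norm v \<le> (\<Sum>i\<in>I. \<bar>n i \<bullet> v\<bar> * norm (n i))"
    by (rule balanced_bounded_below[OF bal]) blast
  \<comment> \<open>\<open>C * \<theta>\<^sup>2\<close> will bound every gap \<open>s i\<close>. In
    \<open>E\<close>, the constant for unit vectors, \<open>N / 2\<close> comes from the component
    along the normal and \<open>2 / \<epsilon> * C\<close> from the tangential one. The 3 in
    \<open>K\<close> counts columns.\<close>
  define N where "N = (\<Sum>i\<in>I. norm (n i))"
  define C where "C = (\<Sum>i\<in>I. norm (n i) * norm (m i)) / 2"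
  define E where "E = N / 2 + 2 / \<epsilon> * C"
  define K where "K = 3 * (N * E / \<beta>)"
  have nonneg: "N \<ge> 0" "C \<ge> 0" "E \<ge> 0" "K \<ge> 0"
    using \<open>\<epsilon> > 0\<close> \<beta>(1) by (auto simp: N_def C_def E_def K_def sum_nonneg)
  have nN: "norm (n i) \<le> N" if "i \<in> I" for i
    unfolding N_def by (rule member_le_sum) (auto simp: that fin)
  show ?thesis
  proof (rule that[of "1 / (K + 1)"])
    show "1 / (K + 1) > 0" using nonneg by simp
  next
    fix Q :: "real^3^3" and c
    assume Q: "orthogonal_matrix Q"
      and small: "(\<Sum>j\<in>UNIV. norm (Q *v axis j 1 - axis j 1)) < 1 / (K + 1)"
      and con: "\<And>i d. \<lbrakk>i \<in> I; norm d < \<epsilon>; n i \<bullet> d = 0\<rbrakk>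
        \<Longrightarrow> n i \<bullet> (Q *v (m i + d) + c) \<le> n i \<bullet> m i"
    define f where "f x = Q *v x - x" for x
    define \<theta> where "\<theta> = (\<Sum>j\<in>UNIV. norm (f (axis j 1)))"
    have \<theta>0: "\<theta> \<ge> 0" by (simp add: \<theta>_def sum_nonneg)
    have f\<theta>: "norm (f x) \<le> \<theta> * norm x" for x
      unfolding f_def \<theta>_def by (rule matrix_vector_norm_columns)
    have flin: "linear f"
      unfolding f_def by (intro linear_compose_sub) (auto simp: linear_ident matrix_vector_mul_linear)
    have polar: "x \<bullet> f y + f x \<bullet> y = - (f x \<bullet> f y)" for x y
      using orthogonal_matrix_inner[OF Q, of x y]
      by (simp add: f_def inner_diff_left inner_diff_right)
    have self: "\<bar>x \<bullet> f x\<bar> \<le> \<theta>\<^sup>2 * (norm x)\<^sup>2 / 2" for x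
    proof -
      have "\<bar>x \<bullet> f x\<bar> = (norm (f x))\<^sup>2 / 2"
        using polar[of x x] inner_ge_zero[of "f x"] inner_commute[of "f x" x]
        unfolding power2_norm_eq_inner by linarith
      also have "\<dots> \<le> (\<theta> * norm x)\<^sup>2 / 2"
        by (intro divide_right_mono power_mono f\<theta>) auto
      finally show ?thesis by (simp add: power_mult_distrib)
    qed
    \<comment> \<open>\<open>f\<close> minus its adjoint is exactly skew, so the moment condition
      applies without error. Together with \<open>polar\<close> this expresses the first-order work
      through the products \<open>f (n i) \<bullet> f (m i)\<close>, which are quadratic in
      \<open>\<theta>\<close>.\<close>
    have "(\<Sum>i\<in>I. n i \<bullet> (f (m i) - (transpose Q *v m i - m i))) = 0"
    proof (rule tor)
      show "linear (\<lambda>x. f x - (transpose Q *v x - x))"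
        by (intro linear_compose_sub flin matrix_vector_mul_linear linear_ident)
      show "(f x - (transpose Q *v x - x)) \<bullet> x = 0" for x
        using dot_lmul_matrix[of x Q x] by (simp add: f_def inner_diff_right inner_commute)
    qed
    moreover
    have "n i \<bullet> (transpose Q *v m i - m i) = f (n i) \<bullet> m i" for i
      using dot_lmul_matrix[of "m i" Q "n i"]
      by (simp add: f_def inner_diff_left inner_diff_right inner_commute)
    then have "n i \<bullet> (f (m i) - (transpose Q *v m i - m i)) = n i \<bullet> f (m i) - f (n i) \<bullet> m i" for i
      by (simp only: inner_diff_right[of "n i" "f (m i)"])
    ultimately have "2 * (\<Sum>i\<in>I. n i \<bullet> f (m i)) = (\<Sum>i\<in>I. n i \<bullet> f (m i) + f (n i) \<bullet> m i)"
      by (simp only: sum_subtractf sum.distrib)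
    then have work: "- (\<Sum>i\<in>I. n i \<bullet> f (m i)) = (\<Sum>i\<in>I. f (n i) \<bullet> f (m i)) / 2"
      by (simp add: polar sum_negf)
    \<comment> \<open>\<open>s i\<close> is the distance, scaled by the length of
      \<open>n i\<close>, by which the contact point retreats behind its facet plane. Zero resultant
      removes \<open>c\<close> from the total.\<close>
    define s where "s i = - (n i \<bullet> (f (m i) + c))" for i
    have s0: "s i \<ge> 0" if "i \<in> I" for i
      using con[OF that, of 0] \<open>\<epsilon> > 0\<close> by (simp add: s_def f_def inner_add_right inner_diff_right)
    have "sum s I = - (\<Sum>i\<in>I. n i \<bullet> f (m i)) - (\<Sum>i\<in>I. n i) \<bullet> c"
      by (simp add: s_def inner_add_right sum.distrib sum_negf inner_sum_left sum_subtractf)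
    also have "\<dots> = (\<Sum>i\<in>I. f (n i) \<bullet> f (m i)) / 2" by (simp add: work n0)
    also have "\<dots> \<le> (\<Sum>i\<in>I. (\<theta> * norm (n i)) * (\<theta> * norm (m i))) / 2"
      by (intro divide_right_mono sum_mono order_trans[OF norm_cauchy_schwarz] mult_mono f\<theta>)
         (auto simp: \<theta>0)
    also have "\<dots> = C * \<theta>\<^sup>2"
      by (simp add: C_def sum_distrib_left power2_eq_square mult_ac)
    finally have sumC: "sum s I \<le> C * \<theta>\<^sup>2" .
    have sC: "s i \<le> C * \<theta>\<^sup>2" if "i \<in> I" for i
      using member_le_sum[of i I s] s0 sumC that fin by force
    have tang: "n i \<bullet> f d \<le> C * \<theta>\<^sup>2" if "i \<in> I" "norm d < \<epsilon>" "n i \<bullet> d = 0" for i d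
    proof -
      have "n i \<bullet> f d \<le> s i"
        using con[OF that] that(3)
        by (simp add: s_def f_def matrix_vector_right_distrib inner_add_right inner_diff_right)
      then show ?thesis using sC[OF that(1)] by simp
    qed
    \<comment> \<open>Using \<open>d\<close> and \<open>- d\<close> gives both signs; scaling by
      half of \<open>\<epsilon>\<close> respects the strict bound in \<open>tang\<close>.\<close>
    have tang': "\<bar>n i \<bullet> f d\<bar> \<le> 2 / \<epsilon> * C * \<theta>\<^sup>2" if "i \<in> I" "norm d \<le> 1" "n i \<bullet> d = 0" for i d
    proof -
      have e: "norm ((\<epsilon> / 2) *\<^sub>R d) < \<epsilon>" 
      proof -
        have "\<epsilon> / 2 * norm d \<le> \<epsilon> / 2 * 1" using that \<open>\<epsilon> > 0\<close> by (intro mult_left_mono) auto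
        then show ?thesis using \<open>\<epsilon> > 0\<close> by simp
      qed
      have "\<bar>n i \<bullet> f ((\<epsilon> / 2) *\<^sub>R d)\<bar> \<le> C * \<theta>\<^sup>2"
        using tang[OF that(1) e] tang[of i "- ((\<epsilon> / 2) *\<^sub>R d)"] that e
        by (simp add: linear_neg[OF flin] abs_le_iff del: scaleR_minus_left norm_scaleR)
      then show ?thesis
        using \<open>\<epsilon> > 0\<close> by (simp add: linear_scale[OF flin] abs_mult field_simps)
    qed
    have bnd: "\<bar>n i \<bullet> f e\<bar> \<le> E * \<theta>\<^sup>2" if i: "i \<in> I" and e: "norm e = 1" for i e
    proof -
      \<comment> \<open>If \<open>n i = 0\<close> then \<open>\<alpha> = 0\<close> by division by zero, and the decomposition still holds.\<close>
      define \<alpha> where "\<alpha> = (e \<bullet> n i) / (n i \<bullet> n i)"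
      define d where "d = e - \<alpha> *\<^sub>R n i"
      have \<alpha>n: "\<alpha> * (n i \<bullet> n i) = e \<bullet> n i" by (simp add: \<alpha>_def)
      have nd: "n i \<bullet> d = 0" by (simp add: d_def inner_diff_right \<alpha>n inner_commute)
      have "e \<bullet> e = \<alpha>\<^sup>2 * (n i \<bullet> n i) + d \<bullet> d"
      proof -
        have "e = \<alpha> *\<^sub>R n i + d" by (simp add: d_def)
        then show ?thesis using nd
          by (simp add: inner_add_left inner_add_right inner_commute power2_eq_square)
      qed
      then have "d \<bullet> d \<le> e \<bullet> e" by simp
      then have d1: "norm d \<le> 1" using e by (simp add: norm_le flip: e)
      have "n i \<bullet> f e = \<alpha> * (n i \<bullet> f (n i)) + n i \<bullet> f d"
        unfolding d_def by (simp add: linear_diff[OF flin] linear_scale[OF flin] inner_diff_right)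
      \<comment> \<open>The factor \<open>(norm (n i))\<^sup>2\<close> supplied by
        \<open>self\<close> cancels the denominator of \<open>\<alpha>\<close>.\<close>
      moreover have "\<bar>\<alpha> * (n i \<bullet> f (n i))\<bar> \<le> N / 2 * \<theta>\<^sup>2"
      proof -
        have "\<bar>\<alpha> * (n i \<bullet> f (n i))\<bar> \<le> \<bar>\<alpha>\<bar> * (\<theta>\<^sup>2 * (norm (n i))\<^sup>2 / 2)"
          unfolding abs_mult by (intro mult_left_mono self) auto
        also have "\<dots> = \<bar>\<alpha> * (n i \<bullet> n i)\<bar> * (\<theta>\<^sup>2 / 2)"
          by (simp add: abs_mult power2_norm_eq_inner)
        also have "\<dots> \<le> N * (\<theta>\<^sup>2 / 2)"
          using Cauchy_Schwarz_ineq2[of e "n i"] nN[OF i] e by (intro mult_right_mono) (auto simp: \<alpha>n)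
        finally show ?thesis by simp
      qed
      ultimately show ?thesis using tang'[OF i d1 nd] by (simp add: E_def algebra_simps)
    qed
    have col: "norm (f (axis j 1)) \<le> N * E / \<beta> * \<theta>\<^sup>2" for j
    proof -
      have "\<beta> * norm (f (axis j 1)) \<le> (\<Sum>i\<in>I. \<bar>n i \<bullet> f (axis j 1)\<bar> * norm (n i))" by (rule \<beta>)
      also have "\<dots> \<le> (\<Sum>i\<in>I. E * \<theta>\<^sup>2 * norm (n i))"
        by (intro sum_mono mult_right_mono bnd) auto
      also have "\<dots> = N * E * \<theta>\<^sup>2" by (simp add: N_def sum_distrib_left sum_distrib_right mult_ac)
      finally show ?thesis using \<beta>(1) by (simp add: field_simps)
    qed
    have "(\<Sum>j\<in>UNIV. norm (f (axis j 1))) \<le> (\<Sum>j\<in>(UNIV :: 3 set). N * E / \<beta> * \<theta>\<^sup>2)"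
      by (intro sum_mono col)
    then have "\<theta> \<le> K * \<theta>\<^sup>2" by (simp add: \<theta>_def[symmetric] K_def)
    moreover have "\<theta> * (K + 1) < 1"
      using small nonneg unfolding \<theta>_def f_def by (simp add: field_simps)
    ultimately have "\<theta> = 0"
    proof -
      assume a: "\<theta> \<le> K * \<theta>\<^sup>2" "\<theta> * (K + 1) < 1"
      have "\<theta> * (1 - K * \<theta>) \<le> 0" using a(1) by (simp add: power2_eq_square algebra_simps)
      moreover have "1 - K * \<theta> > 0" using a(2) \<theta>0 by (simp add: algebra_simps)
      ultimately show ?thesis using \<theta>0 by (simp add: mult_le_0_iff)
    qed
    then have fz: "f x = 0" for x using f\<theta>[of x] by simp
    then have "Q = mat 1" by (auto simp: f_def matrix_eq)
    moreover have "n i \<bullet> c = 0" if "i \<in> I" for i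
    proof -
      have "sum s I = 0" using sumC s0 \<open>\<theta> = 0\<close> by (simp add: antisym sum_nonneg)
      then have "s i = 0" using s0 fin that by (simp add: sum_nonneg_eq_0_iff)
      then show ?thesis by (simp add: s_def fz)
    qed
    then have "c = 0" using sp by blast
    ultimately show "Q = mat 1 \<and> c = 0" ..
  qed
qed

section \<open>Contacts that immobilise a convex body\<close>

text \<open>\<open>facet_point K m n\<close> says that near \<open>m\<close> the set \<open>K\<close> fills the half-space with
  outer normal \<open>n\<close>, as a polyhedron does near a relative interior point of a facet.\<close>

definition facet_point :: "(real^3) set \<Rightarrow> real^3 \<Rightarrow> real^3 \<Rightarrow> bool" where
  "facet_point K m n \<longleftrightarrow> (\<exists>\<epsilon>>0. \<forall>x\<in>ball m \<epsilon>. n \<bullet> x \<le> n \<bullet> m \<longrightarrow> x \<in> K)"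

text \<open>Contact points lie on the boundary of \<open>A\<close>, while disjointness concerns
  interiors. Convexity puts \<open>p\<close> in the closure of \<open>interior A\<close>, so some
  interior point near \<open>p\<close> would be carried into \<open>interior B\<close> as
  well.\<close>

lemma rigid_image_avoids_interior:
  fixes Q :: "real^3^3"
  assumes Q: "orthogonal_matrix Q" and A: "convex A" "interior A \<noteq> {}" "p \<in> A"
    and dis: "interior ((\<lambda>x. Q *v x + c) ` A) \<inter> interior B = {}"
  shows "Q *v p + c \<notin> interior B"
proof
  let ?g = "\<lambda>x. Q *v x + c"
  assume "?g p \<in> interior B"
  then have p: "p \<in> ?g -` interior B" by simp
  have op: "open (?g -` interior B)"
    by (intro open_vimage continuous_intros) auto
  have "p \<in> closure (interior A)"
    using A convex_closure_interior[of A] closure_subset by blast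
  then obtain y where y: "y \<in> interior A" "?g y \<in> interior B"
    using open_Int_closure_eq_empty[OF op, of "interior A"] p by blast
  have inj: "inj ((*v) Q)"
    using Q orthogonal_transformation_inj orthogonal_transformation_matrix[of "(*v) Q"] by auto
  have "?g ` A = (+) c ` ((*v) Q ` A)" by (auto simp: image_image add.commute)
  then have "interior (?g ` A) = (+) c ` ((*v) Q ` interior A)"
    by (simp add: interior_translation interior_injective_linear_image[OF _ inj])
  then have "?g y \<in> interior (?g ` A)"
    using y by (auto simp: image_image add.commute)
  then show False using y dis by blast
qed

lemma finite_uniform_radius:
  fixes P :: "'i \<Rightarrow> real \<Rightarrow> bool"
  assumes "finite I" "\<And>i. i \<in> I \<Longrightarrow> \<exists>e>0. P i e"
    and "\<And>i e e'. P i e \<Longrightarrow> e' \<le> e \<Longrightarrow> P i e'"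
  obtains e where "e > 0" "\<And>i. i \<in> I \<Longrightarrow> P i e"
proof -
  have "\<exists>e>0. \<forall>i\<in>I. P i e"
    using assms(1,2)
  proof (induction I rule: finite_induct)
    case (insert i I)
    obtain e where e: "e > 0" "\<forall>i\<in>I. P i e" using insert by auto
    obtain e' where e': "e' > 0" "P i e'" using insert by auto
    show ?case using e e' by (intro exI[of _ "min e e'"]) (auto intro: assms(3))
  qed (auto intro: exI[of _ 1])
  then show ?thesis using that by blast
qed

text \<open>The identity is isolated among the admissible motions, so a continuous path that starts
  there stays there, whereas \<open>A\<close> meets the open slab.\<close>

lemma not_removable_if_balanced_contacts:
  fixes m n :: "'i \<Rightarrow> real^3"
  assumes A: "convex A" "interior A \<noteq> {}" and bal: "balanced I m n"
    and fA: "\<And>i. i \<in> I \<Longrightarrow> facet_point A (m i) (n i)"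
    and fB: "\<And>i. i \<in> I \<Longrightarrow> \<exists>B\<in>L-{A}. facet_point B (m i) (- n i)"
    and slab: "A \<inter> open_slab \<nu> a b \<noteq> {}"
  shows "\<not> removable \<nu> a b L A"
proof
  assume "removable \<nu> a b L A"
  then obtain g :: "real \<Rightarrow> real^3 \<Rightarrow> real^3" where
    rig: "\<forall>t\<in>{0..1}. rigid_motion (g t)"
    and cont: "continuous_on ({0..1} \<times> UNIV) (\<lambda>(t, x). g t x)"
    and g0: "g 0 = id"
    and dis: "\<forall>t\<in>{0..1}. \<forall>B\<in>L - {A}. interior (g t ` A) \<inter> interior B = {}"
    and g1: "g 1 ` A \<inter> open_slab \<nu> a b = {}"
    unfolding removable_def by (elim exE conjE)
  have fin: "finite I" using bal by (simp add: balanced_def)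
  obtain \<epsilon> where \<epsilon>: "\<epsilon> > 0"
    and \<epsilon>AB: "\<And>i. i \<in> I \<Longrightarrow> (\<forall>x\<in>ball (m i) \<epsilon>. n i \<bullet> x \<le> n i \<bullet> m i \<longrightarrow> x \<in> A) \<and>
      (\<exists>B\<in>L-{A}. \<forall>x\<in>ball (m i) \<epsilon>. n i \<bullet> x \<ge> n i \<bullet> m i \<longrightarrow> x \<in> B)"
  proof (rule finite_uniform_radius[OF fin, where P = "\<lambda>i e.
      (\<forall>x\<in>ball (m i) e. n i \<bullet> x \<le> n i \<bullet> m i \<longrightarrow> x \<in> A) \<and>
      (\<exists>B\<in>L-{A}. \<forall>x\<in>ball (m i) e. n i \<bullet> x \<ge> n i \<bullet> m i \<longrightarrow> x \<in> B)"])
    fix i assume i: "i \<in> I"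
    obtain e1 where e1: "e1 > 0" "\<forall>x\<in>ball (m i) e1. n i \<bullet> x \<le> n i \<bullet> m i \<longrightarrow> x \<in> A"
      using fA[OF i] by (auto simp: facet_point_def)
    obtain B e2 where e2: "B \<in> L - {A}" "e2 > 0"
      "\<forall>x\<in>ball (m i) e2. n i \<bullet> x \<ge> n i \<bullet> m i \<longrightarrow> x \<in> B"
      using fB[OF i] by (auto simp: facet_point_def)
    show "\<exists>e>0. (\<forall>x\<in>ball (m i) e. n i \<bullet> x \<le> n i \<bullet> m i \<longrightarrow> x \<in> A) \<and>
      (\<exists>B\<in>L-{A}. \<forall>x\<in>ball (m i) e. n i \<bullet> x \<ge> n i \<bullet> m i \<longrightarrow> x \<in> B)"
      using e1 e2 by (intro exI[of _ "min e1 e2"] conjI bexI[of _ B]) auto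
  next
    fix i and e e' :: real
    assume P: "(\<forall>x\<in>ball (m i) e. n i \<bullet> x \<le> n i \<bullet> m i \<longrightarrow> x \<in> A) \<and>
      (\<exists>B\<in>L-{A}. \<forall>x\<in>ball (m i) e. n i \<bullet> x \<ge> n i \<bullet> m i \<longrightarrow> x \<in> B)" and "e' \<le> e"
    then have "ball (m i) e' \<subseteq> ball (m i) e" by (simp add: subset_ball)
    with P show "(\<forall>x\<in>ball (m i) e'. n i \<bullet> x \<le> n i \<bullet> m i \<longrightarrow> x \<in> A) \<and>
      (\<exists>B\<in>L-{A}. \<forall>x\<in>ball (m i) e'. n i \<bullet> x \<ge> n i \<bullet> m i \<longrightarrow> x \<in> B)"
      by blast
  qed blast
  obtain \<delta> where \<delta>: "\<delta> > 0"
    and rigid: "\<And>Q c. \<lbrakk>orthogonal_matrix Q; (\<Sum>j\<in>UNIV. norm (Q *v axis j 1 - axis j 1)) < \<delta>;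
        \<And>i d. \<lbrakk>i \<in> I; norm d < \<epsilon> / 2; n i \<bullet> d = 0\<rbrakk> \<Longrightarrow> n i \<bullet> (Q *v (m i + d) + c) \<le> n i \<bullet> m i\<rbrakk>
      \<Longrightarrow> Q = mat 1 \<and> c = 0"
    using balanced_rigid_near_identity[OF bal, of "\<epsilon> / 2"] \<epsilon> by auto
  \<comment> \<open>If \<open>h t < \<eta>\<close>, points near a contact move by at most half of
    \<open>\<epsilon>\<close>; the other half is left for the tangential offset \<open>d\<close>.
    The summand 1 in \<open>M\<close> accounts for the translation part.\<close>
  define M where "M = (\<Sum>i\<in>I. norm (m i)) + \<epsilon> + 1"
  have M: "norm (m i) + \<epsilon> + 1 \<le> M" if "i \<in> I" for i
    using member_le_sum[of i I "\<lambda>i. norm (m i)"] that fin by (simp add: M_def)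
  have M0: "M > 0" using \<epsilon> by (simp add: M_def add_nonneg_pos sum_nonneg)
  define \<eta> where "\<eta> = min \<delta> (\<epsilon> / 2 / M)"
  have \<eta>: "\<eta> > 0" "\<eta> \<le> \<delta>" "\<eta> * M \<le> \<epsilon> / 2"
    using \<delta> \<epsilon> M0 by (auto simp: \<eta>_def min_def field_simps)
  \<comment> \<open>The distance from the identity is read off from the images of 0 and the unit
    vectors; this avoids a continuous choice of \<open>Q\<close> and \<open>c\<close>.\<close>
  define h where "h t = norm (g t 0) + (\<Sum>j\<in>UNIV. norm (g t (axis j 1) - g t 0 - axis j 1))" for t
  have gc: "continuous_on {0..1} (\<lambda>t. g t x)" for x
  proof -
    have "continuous_on {0..1} (\<lambda>t. (t, x))" by (intro continuous_intros)
    moreover have "(\<lambda>t. (t, x)) ` {0..1::real} \<subseteq> {0..1} \<times> UNIV" by auto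
    ultimately show ?thesis using continuous_on_compose2[OF cont, of "{0..1}" "\<lambda>t. (t, x)"] by simp
  qed
  have hc: "continuous_on {0..1} h"
    unfolding h_def by (intro continuous_intros gc)
  have step: "g t = id" if t: "t \<in> {0..1}" and ht: "h t < \<eta>" for t
  proof -
    obtain Q c where Q: "orthogonal_matrix Q" and gt: "g t = (\<lambda>x. Q *v x + c)"
      using bspec[OF rig t] by (auto simp: rigid_motion_def rotation_matrix_def)
    define \<theta> where "\<theta> = (\<Sum>j\<in>UNIV. norm (Q *v axis j 1 - axis j 1))"
    have h: "h t = norm c + \<theta>" by (simp add: h_def gt \<theta>_def)
    have "\<theta> < \<delta>" using ht \<eta> h by (smt (verit) norm_ge_zero)
    moreover have "n i \<bullet> (Q *v (m i + d) + c) \<le> n i \<bullet> m i"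
      if i: "i \<in> I" and d: "norm d < \<epsilon> / 2" "n i \<bullet> d = 0" for i d
    proof (rule ccontr)
      let ?p = "m i + d"
      \<comment> \<open>A point pushed strictly across the facet plane lands in an open half-ball
        filled by the neighbour \<open>B\<close>, hence in its interior.\<close>
      assume out: "\<not> n i \<bullet> (Q *v ?p + c) \<le> n i \<bullet> m i"
      obtain B where B: "B \<in> L - {A}" "\<forall>x\<in>ball (m i) \<epsilon>. n i \<bullet> x \<ge> n i \<bullet> m i \<longrightarrow> x \<in> B"
        using \<epsilon>AB[OF i] by blast
      have "?p \<in> ball (m i) \<epsilon>" using d \<epsilon> by (simp add: dist_norm)
      then have pA: "?p \<in> A" using \<epsilon>AB[OF i] d(2) by (auto simp: inner_add_right)
      have np: "norm ?p + 1 \<le> M" using M[OF i] norm_triangle_ineq[of "m i" d] d(1) \<epsilon> by linarith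
      have "dist (m i) (Q *v ?p + c) \<le> norm d + norm (Q *v ?p - ?p) + norm c"
      proof -
        have "dist (m i) (Q *v ?p + c) = norm (d + (Q *v ?p - ?p) + c)"
          by (simp add: dist_norm norm_minus_commute[of "m i"] add_diff_eq diff_add_eq)
        then show ?thesis
          using norm_triangle_ineq[of "d + (Q *v ?p - ?p)" c] norm_triangle_ineq[of d "Q *v ?p - ?p"]
          by linarith
      qed
      also have "\<dots> \<le> norm d + (\<theta> * norm ?p + norm c * 1)"
        using matrix_vector_norm_columns[of Q ?p] by (simp add: \<theta>_def)
      also have "\<theta> * norm ?p + norm c * 1 \<le> (norm c + \<theta>) * (norm ?p + 1)"
        by (simp add: algebra_simps \<theta>_def sum_nonneg)
      also have "\<dots> \<le> \<eta> * M"
        using ht np \<eta> by (intro mult_mono) (auto simp: h)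
      also have "norm d + \<eta> * M < \<epsilon>" using d \<eta> by simp
      finally have "Q *v ?p + c \<in> ball (m i) \<epsilon> \<inter> {x. n i \<bullet> x > n i \<bullet> m i}" using out by simp
      moreover have "open (ball (m i) \<epsilon> \<inter> {x. n i \<bullet> x > n i \<bullet> m i})"
        by (intro open_Int open_ball open_halfspace_gt)
      moreover have "ball (m i) \<epsilon> \<inter> {x. n i \<bullet> x > n i \<bullet> m i} \<subseteq> B" using B by auto
      ultimately have "Q *v ?p + c \<in> interior B" using interiorI by blast
      then show False
        using rigid_image_avoids_interior[OF Q A pA] bspec[OF bspec[OF dis t] B(1)] gt by auto
    qed
    ultimately have "Q = mat 1 \<and> c = 0" using rigid[OF Q] \<theta>_def by blast
    then show ?thesis by (auto simp: gt)
  qed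
  have "h 1 < \<eta>"
  proof (rule ccontr)
    assume "\<not> h 1 < \<eta>"
    moreover have "h 0 = 0" by (simp add: h_def g0)
    \<comment> \<open>\<open>h\<close> would have to pass through \<open>\<eta> / 2\<close>, but by
      \<open>step\<close> every value below \<open>\<eta>\<close> is 0.\<close>
    ultimately obtain t where t: "0 \<le> t" "t \<le> 1" "h t = \<eta> / 2"
      using IVT'[of h 0 "\<eta> / 2" 1] hc \<eta> by auto
    then have "g t = id" using step \<eta> by auto
    then have "h t = 0" by (simp add: h_def)
    then show False using t \<eta> by simp
  qed
  then have "g 1 = id" using step by simp
  then show False using g1 slab by simp
qed

section \<open>Facet points and balance under translation, reflection and scaling\<close>

lemma facet_point_translate:
  assumes "facet_point K m n"
  shows "facet_point ((\<lambda>x. w + x) ` K) (w + m) n"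
proof -
  obtain \<epsilon> where \<epsilon>: "\<epsilon> > 0" "\<And>x. x \<in> ball m \<epsilon> \<Longrightarrow> n \<bullet> x \<le> n \<bullet> m \<Longrightarrow> x \<in> K"
    using assms by (auto simp: facet_point_def)
  have "x \<in> (\<lambda>x. w + x) ` K" if "x \<in> ball (w + m) \<epsilon>" "n \<bullet> x \<le> n \<bullet> (w + m)" for x
  proof
    show "x = w + (x - w)" by simp
    show "x - w \<in> K"
      by (rule \<epsilon>(2)) (use that in \<open>auto simp: dist_norm algebra_simps inner_diff_right inner_add_right\<close>)
  qed
  with \<epsilon>(1) show ?thesis by (auto simp: facet_point_def)
qed

lemma facet_point_uminus:
  assumes "facet_point K m n"
  shows "facet_point (uminus ` K) (- m) (- n)"
proof -
  obtain \<epsilon> where \<epsilon>: "\<epsilon> > 0" "\<And>x. x \<in> ball m \<epsilon> \<Longrightarrow> n \<bullet> x \<le> n \<bullet> m \<Longrightarrow> x \<in> K"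
    using assms by (auto simp: facet_point_def)
  have "x \<in> uminus ` K" if "x \<in> ball (- m) \<epsilon>" "(- n) \<bullet> x \<le> (- n) \<bullet> (- m)" for x
  proof
    show "x = - (- x)" by simp
    show "- x \<in> K"
      by (rule \<epsilon>(2)) (use that in \<open>auto simp: dist_norm norm_minus_commute add.commute\<close>)
  qed
  with \<epsilon>(1) show ?thesis unfolding facet_point_def by blast
qed

lemma facet_point_scale:
  assumes "facet_point K m n" "r > 0"
  shows "facet_point ((*\<^sub>R) r ` K) (r *\<^sub>R m) n"
proof -
  obtain \<epsilon> where \<epsilon>: "\<epsilon> > 0" "\<And>x. x \<in> ball m \<epsilon> \<Longrightarrow> n \<bullet> x \<le> n \<bullet> m \<Longrightarrow> x \<in> K"
    using assms by (auto simp: facet_point_def)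
  have "x \<in> (*\<^sub>R) r ` K" if x: "x \<in> ball (r *\<^sub>R m) (r * \<epsilon>)" "n \<bullet> x \<le> n \<bullet> (r *\<^sub>R m)" for x
  proof
    show "x = r *\<^sub>R ((1 / r) *\<^sub>R x)" using assms(2) by simp
    show "(1 / r) *\<^sub>R x \<in> K"
    proof (rule \<epsilon>(2))
      have "m - (1 / r) *\<^sub>R x = (1 / r) *\<^sub>R (r *\<^sub>R m - x)"
        using assms(2) by (simp add: scaleR_diff_right)
      then have "norm (m - (1 / r) *\<^sub>R x) = norm (r *\<^sub>R m - x) / r"
        using assms(2) by simp
      then show "(1 / r) *\<^sub>R x \<in> ball m \<epsilon>"
        using x(1) assms(2) by (simp add: dist_norm divide_less_eq mult.commute)
      show "n \<bullet> ((1 / r) *\<^sub>R x) \<le> n \<bullet> m"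
        using x(2) assms(2) by (simp add: divide_le_eq mult.commute)
    qed
  qed
  moreover have "r * \<epsilon> > 0" using \<epsilon>(1) assms(2) by simp
  ultimately show ?thesis unfolding facet_point_def by blast
qed

lemma facet_point_interior_nonempty:
  assumes "facet_point K m n" "n \<noteq> 0"
  shows "interior K \<noteq> {}"
proof -
  obtain \<epsilon> where \<epsilon>: "\<epsilon> > 0" "\<And>x. x \<in> ball m \<epsilon> \<Longrightarrow> n \<bullet> x \<le> n \<bullet> m \<Longrightarrow> x \<in> K"
    using assms by (auto simp: facet_point_def)
  let ?U = "ball m \<epsilon> \<inter> {x. n \<bullet> x < n \<bullet> m}"
  define y where "y = m - (\<epsilon> / 2 / norm n) *\<^sub>R n"
  have "dist m y < \<epsilon>" using \<epsilon>(1) assms(2) by (simp add: y_def dist_norm)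
  moreover have "n \<bullet> y < n \<bullet> m"
    using \<epsilon>(1) assms(2) by (simp add: y_def inner_diff_right)
  ultimately have "y \<in> ?U" by simp
  moreover have "open ?U" by (intro open_Int open_ball open_halfspace_lt)
  moreover have "?U \<subseteq> K" using \<epsilon>(2) by auto
  ultimately show ?thesis using interiorI by blast
qed

text \<open>For forces with zero resultant the total moment does not depend on the origin.\<close>

lemma balanced_translate:
  assumes "balanced I m n"
  shows "balanced I (\<lambda>i. w + m i) n"
proof -
  have "(\<Sum>i\<in>I. n i \<bullet> f (w + m i)) = 0" if f: "linear f" "\<forall>x. f x \<bullet> x = 0" for f
  proof -
    have "(\<Sum>i\<in>I. n i \<bullet> f (w + m i)) = (\<Sum>i\<in>I. n i) \<bullet> f w + (\<Sum>i\<in>I. n i \<bullet> f (m i))"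
      by (simp add: linear_add[OF f(1)] inner_add_right sum.distrib inner_sum_left)
    then show ?thesis using assms f by (simp add: balanced_def)
  qed
  then show ?thesis using assms by (auto simp: balanced_def)
qed

lemma balanced_uminus:
  assumes "balanced I m n"
  shows "balanced I (\<lambda>i. - m i) (\<lambda>i. - n i)"
proof -
  have "(\<Sum>i\<in>I. - n i \<bullet> f (- m i)) = (\<Sum>i\<in>I. n i \<bullet> f (m i))" if "linear f" for f
    by (simp add: linear_neg[OF that])
  then show ?thesis using assms by (simp add: balanced_def sum_negf)
qed

section \<open>Layers spanned by finitely many locked polytopes\<close>

lemma interior_disjoint_if_separated:
  fixes A B :: "'a::euclidean_space set"
  assumes "\<And>x. x \<in> A \<Longrightarrow> n \<bullet> x \<le> c" "\<And>x. x \<in> B \<Longrightarrow> c \<le> n \<bullet> x" "n \<noteq> 0"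
  shows "interior A \<inter> interior B = {}"
proof -
  have "A \<subseteq> {x. n \<bullet> x \<le> c}" "B \<subseteq> {x. n \<bullet> x \<ge> c}" using assms by auto
  from this[THEN interior_mono] have "interior A \<subseteq> {x. n \<bullet> x < c}" "interior B \<subseteq> {x. n \<bullet> x > c}"
    unfolding interior_halfspace_le[OF assms(3)] interior_halfspace_ge[OF assms(3)] .
  then show ?thesis by force
qed

lemma lattice2_zero: "0 \<in> lattice2 u v"
  unfolding lattice2_def by (intro CollectI exI[of _ 0]) simp

lemma lattice2_diff:
  assumes "w \<in> lattice2 u v" "w' \<in> lattice2 u v"
  shows "w - w' \<in> lattice2 u v"
proof -
  obtain i j i' j' :: int where "w = of_int i *\<^sub>R u + of_int j *\<^sub>R v" "w' = of_int i' *\<^sub>R u + of_int j' *\<^sub>R v"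
    using assms by (auto simp: lattice2_def)
  then have "w - w' = of_int (i - i') *\<^sub>R u + of_int (j - j') *\<^sub>R v"
    by (simp add: algebra_simps)
  then show ?thesis unfolding lattice2_def by blast
qed

lemma lattice2_add:
  assumes "w \<in> lattice2 u v" "w' \<in> lattice2 u v"
  shows "w + w' \<in> lattice2 u v"
  using lattice2_diff[OF assms(1) lattice2_diff[OF lattice2_zero assms(2)]] by simp

lemma congruent_sets_translate:
  assumes "congruent_sets T A"
  shows "congruent_sets T ((\<lambda>x. w + x) ` A)"
proof -
  obtain Q :: "real^3^3" and c where "orthogonal_matrix Q" "A = (\<lambda>x. Q *v x + c) ` T"
    using assms by (auto simp: congruent_sets_def)
  then have "(\<lambda>x. w + x) ` A = (\<lambda>x. Q *v x + (w + c)) ` T"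
    by (simp add: image_image algebra_simps)
  then show ?thesis using \<open>orthogonal_matrix Q\<close> by (auto simp: congruent_sets_def)
qed

text \<open>Congruence admits orthogonal matrices of either determinant, so \<open>- Q\<close> may
  replace \<open>Q\<close>. This covers the reflected tetrahedra.\<close>

lemma congruent_sets_uminus:
  assumes "congruent_sets T A"
  shows "congruent_sets T (uminus ` A)"
proof -
  obtain Q :: "real^3^3" and c where Q: "orthogonal_matrix Q" "A = (\<lambda>x. Q *v x + c) ` T"
    using assms by (auto simp: congruent_sets_def)
  have "orthogonal_matrix (- Q)"
    using Q(1) by (simp add: orthogonal_matrix_def transpose_def matrix_matrix_mult_def vec_eq_iff)
  moreover have "uminus ` A = (\<lambda>x. (- Q) *v x + (- c)) ` T"
    unfolding Q(2) image_image
    by (intro image_cong refl) (simp add: matrix_vector_mult_def vec_eq_iff sum_negf)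
  ultimately show ?thesis unfolding congruent_sets_def by blast
qed

text \<open>All conditions are invariant under lattice translations, so they need checking only from
  members of \<open>F\<close>. Neighbours are required to differ from \<open>A\<close> as sets,
  since coinciding translates are one element of the layer.\<close>

lemma interlocking_layer_exists:
  fixes F :: "(real^3) set set"
  assumes F: "finite F" "F \<noteq> {}"
    and poly: "\<And>A. A \<in> F \<Longrightarrow> polytope A \<and> interior A \<noteq> {} \<and> congruent_sets T A"
    and uv: "cross3 u v \<noteq> 0"
    and disj: "\<And>A B w. \<lbrakk>A \<in> F; B \<in> F; w \<in> lattice2 u v; (\<lambda>x. w + x) ` B \<noteq> A\<rbrakk>
      \<Longrightarrow> interior A \<inter> interior ((\<lambda>x. w + x) ` B) = {}"
    and contact: "\<And>A. A \<in> F \<Longrightarrow> \<exists>(I :: 'i set) m n. balanced I m n \<and>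
      (\<forall>i\<in>I. facet_point A (m i) (n i) \<and> (\<exists>B\<in>F. \<exists>w\<in>lattice2 u v.
         (\<lambda>x. w + x) ` B \<noteq> A \<and> facet_point ((\<lambda>x. w + x) ` B) (m i) (- n i)))"
  shows "\<exists>n a b L. is_layer n a b L \<and> (\<forall>A\<in>L. congruent_sets T A) \<and> full_interlocking n a b L"
proof -
  define \<nu> where "\<nu> = cross3 u v"
  have \<nu>u: "\<nu> \<bullet> u = 0" and \<nu>v: "\<nu> \<bullet> v = 0" by (simp_all add: \<nu>_def dot_cross_self)
  have \<nu>w: "\<nu> \<bullet> w = 0" if "w \<in> lattice2 u v" for w
    using that \<nu>u \<nu>v by (auto simp: lattice2_def inner_add_right)
  have "bounded (\<Union>F)" using poly by (intro bounded_Union F ballI) (simp add: polytope_imp_bounded)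
  then obtain R where R: "\<And>A x. A \<in> F \<Longrightarrow> x \<in> A \<Longrightarrow> norm x \<le> R"
    by (auto simp: bounded_iff)
  define b where "b = norm \<nu> * R + 1"
  have inside: "\<bar>\<nu> \<bullet> x\<bar> < b" if "A \<in> F" "x \<in> A" for A x
  proof -
    have "\<bar>\<nu> \<bullet> x\<bar> \<le> norm \<nu> * norm x" by (rule Cauchy_Schwarz_ineq2)
    also have "\<dots> \<le> norm \<nu> * R" using R[OF that] by (intro mult_left_mono) auto
    finally show ?thesis by (simp add: b_def)
  qed
  define L where "L = {(\<lambda>x. w + x) ` A | w A. w \<in> lattice2 u v \<and> A \<in> F}"
  have LE: thesis if "X \<in> L" "\<And>w A. w \<in> lattice2 u v \<Longrightarrow> A \<in> F \<Longrightarrow> X = (\<lambda>x. w + x) ` A \<Longrightarrow> thesis"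
    for X thesis using that by (auto simp: L_def)
  have insideL: "\<bar>\<nu> \<bullet> x\<bar> < b" if "X \<in> L" "x \<in> X" for X x
    using that(1) by (rule LE) (use that(2) inside \<nu>w in \<open>auto simp: inner_add_right\<close>)
  have polyL: "polytope X \<and> interior X \<noteq> {}" if "X \<in> L" for X
    using that by (rule LE) (use poly in \<open>auto simp: interior_translation polytope_translation_eq\<close>)
  \<comment> \<open>This lets two elements be translated together until the first is a member of
    \<open>F\<close>.\<close>
  have shift: "(\<lambda>x. w + x) ` X = (\<lambda>x. w' + x) ` ((\<lambda>x. (w - w') + x) ` X)" for w w' :: "real^3" and X
    by (simp add: image_image algebra_simps)
  have "is_layer \<nu> (- b) b L"
    unfolding is_layer_def
  proof (intro conjI ballI impI)
    show "\<nu> \<noteq> 0" using uv by (simp add: \<nu>_def)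
    obtain A where "A \<in> F" "interior A \<noteq> {}" using F poly by blast
    then obtain x where "x \<in> A" using interior_subset by blast
    then show "- b < b" using inside[of A x] \<open>A \<in> F\<close> by linarith
  next
    fix X Y assume XY: "X \<in> L" "Y \<in> L" "X \<noteq> Y"
    obtain w A where A: "w \<in> lattice2 u v" "A \<in> F" "X = (\<lambda>x. w + x) ` A" using XY(1) by (rule LE)
    obtain w' B where B: "w' \<in> lattice2 u v" "B \<in> F" "Y = (\<lambda>x. w' + x) ` B" using XY(2) by (rule LE)
    let ?B = "(\<lambda>x. (w' - w) + x) ` B"
    have Y: "Y = (\<lambda>x. w + x) ` ?B" using B(3) shift by simp
    have "interior A \<inter> interior ?B = {}"
      using XY(3) A(3) Y by (intro disj A B lattice2_diff) auto
    then have "(\<lambda>x. w + x) ` (interior A \<inter> interior ?B) = {}" by simp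
    then show "interior X \<inter> interior Y = {}"
      unfolding A(3) Y interior_translation by (subst (asm) image_Int) auto
  next
    fix X assume "X \<in> L"
    then show "X \<subseteq> closed_slab \<nu> (- b) b"
      using insideL by (force simp: closed_slab_def abs_less_iff)
  next
    have "F \<subseteq> L"
    proof
      fix A assume "A \<in> F"
      then show "A \<in> L" unfolding L_def using lattice2_zero
        by (intro CollectI exI[of _ 0] exI[of _ A]) auto
    qed
    moreover have col: "\<not> collinear {0, u, v}" using uv by (simp add: cross_eq_0)
    then have "u \<noteq> v" by auto
    moreover have "independent {u, v}"
    proof -
      have col': "\<not> collinear {0, v, u}" using col by (simp add: insert_commute)
      then have "u \<notin> span {v}"
        using col' by (auto simp: span_singleton collinear_lemma)
      moreover have "v \<noteq> 0" using col' by auto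
      ultimately show ?thesis using \<open>u \<noteq> v\<close> by (simp add: independent_insert)
    qed
    ultimately show "\<exists>u v. u \<noteq> v \<and> independent {u, v} \<and> \<nu> \<bullet> u = 0 \<and> \<nu> \<bullet> v = 0 \<and>
        (\<exists>F. finite F \<and> F \<noteq> {} \<and> F \<subseteq> L \<and>
           L = {(\<lambda>x. w + x) ` A | w A. w \<in> lattice2 u v \<and> A \<in> F})"
      using \<nu>u \<nu>v F L_def by blast
  qed (use polyL in blast)+
  moreover have "congruent_sets T X" if "X \<in> L" for X
    using that by (rule LE) (simp add: poly congruent_sets_translate)
  moreover have "full_interlocking \<nu> (- b) b L"
    unfolding full_interlocking_def
  proof
    fix X assume X: "X \<in> L"
    obtain w A where A: "w \<in> lattice2 u v" "A \<in> F" "X = (\<lambda>x. w + x) ` A" using X by (rule LE)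
    obtain I :: "'i set" and m n where bal: "balanced I m n"
      and con: "\<And>i. i \<in> I \<Longrightarrow> facet_point A (m i) (n i)"
      "\<And>i. i \<in> I \<Longrightarrow> \<exists>B\<in>F. \<exists>w\<in>lattice2 u v.
         (\<lambda>x. w + x) ` B \<noteq> A \<and> facet_point ((\<lambda>x. w + x) ` B) (m i) (- n i)"
      using contact[OF A(2)] by blast
    show "\<not> removable \<nu> (- b) b L X"
    proof (rule not_removable_if_balanced_contacts[OF _ _ balanced_translate[OF bal, of w]])
      show "convex X" using polyL[OF X] polytope_imp_convex by blast
      show "interior X \<noteq> {}" using polyL[OF X] by blast
      then obtain x where "x \<in> X" using interior_subset by blast
      then show "X \<inter> open_slab \<nu> (- b) b \<noteq> {}"
        using insideL[OF X, of x] by (auto simp: open_slab_def abs_less_iff)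
    next
      fix i assume i: "i \<in> I"
      show "facet_point X (w + m i) (n i)"
        unfolding A(3) by (rule facet_point_translate[OF con(1)[OF i]])
      obtain B w' where B: "B \<in> F" "w' \<in> lattice2 u v" "(\<lambda>x. w' + x) ` B \<noteq> A"
        "facet_point ((\<lambda>x. w' + x) ` B) (m i) (- n i)"
        using con(2)[OF i] by blast
      let ?Y = "(\<lambda>x. w + x) ` ((\<lambda>x. w' + x) ` B)"
      have "?Y = (\<lambda>x. (w + w') + x) ` B" by (simp add: image_image add.assoc)
      then have "?Y \<in> L" unfolding L_def using B lattice2_add[OF A(1) B(2)] by blast
      moreover have "?Y \<noteq> X" unfolding A(3) using B(3) by (simp add: inj_image_eq_iff)
      ultimately show "\<exists>Y\<in>L - {X}. facet_point Y (w + m i) (- n i)"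
        using facet_point_translate[OF B(4), of w] by blast
    qed
  qed
  ultimately show ?thesis by blast
qed

section \<open>Hexagonal layers of centrally symmetric polytopes\<close>

lemma facet_point_mem:
  assumes "facet_point K m n" shows "m \<in> K"
  using assms by (auto simp: facet_point_def)

text \<open>Up to sign these are the values of \<open>\<nu> $ k\<close> at a lattice vector, in
  units of \<open>r * c\<close>. If all were at most 1 in absolute value, adding the third to the
  first or second would bound \<open>3 * i\<close> and \<open>3 * j\<close> by 2, forcing both
  indices to vanish.\<close>

lemma three_vector_lattice_large:
  assumes "(i :: int) \<noteq> 0 \<or> j \<noteq> 0"
  shows "\<bar>2 * i - j\<bar> \<ge> 2 \<or> \<bar>2 * j - i\<bar> \<ge> 2 \<or> \<bar>i + j\<bar> \<ge> 2"
  using assms by arith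

text \<open>Translation by twice a contact point brings the opposite facet of the copy to that
  point. Forces cancel in opposite pairs. The hypothesis with \<open>\<kappa>\<close> and
  \<open>e\<close> yields zero moment: the part of a normal along its contact point has no moment,
  and the common part \<open>e\<close> meets contact points with zero sum.\<close>

lemma hexagonal_layer_exists:
  fixes P :: "(real^3) set" and \<mu> \<nu> :: "real^3^3"
  assumes P: "polytope P" "uminus ` P = P"
    and bound: "\<And>k x. x \<in> P \<Longrightarrow> \<nu> $ k \<bullet> x \<le> c" and c: "c > 0"
    and dot: "\<And>k. \<nu> $ k \<bullet> \<mu> $ k = c" "\<And>j k. j \<noteq> k \<Longrightarrow> \<nu> $ k \<bullet> \<mu> $ j = - c / 2"
    and \<mu>0: "\<mu> $ 1 + \<mu> $ 2 + \<mu> $ 3 = 0"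
    and \<nu>\<mu>: "\<And>k. \<nu> $ k = \<kappa> *\<^sub>R \<mu> $ k + e"
    and sp: "\<And>v. (\<And>k. \<nu> $ k \<bullet> v = 0) \<Longrightarrow> v = 0"
    and facet: "\<And>k. facet_point P (\<mu> $ k) (\<nu> $ k)"
    and r: "r > 0" and T: "congruent_sets T ((*\<^sub>R) r ` P)"
  shows "\<exists>n a b L. is_layer n a b L \<and> (\<forall>A\<in>L. congruent_sets T A) \<and> full_interlocking n a b L"
proof -
  define K where "K = (*\<^sub>R) r ` P"
  define u where "u = (2 * r) *\<^sub>R \<mu> $ 1"
  define v where "v = (2 * r) *\<^sub>R \<mu> $ 2"
  have \<mu>3: "\<mu> $ 3 = - \<mu> $ 1 - \<mu> $ 2" using \<mu>0 by (simp add: algebra_simps eq_neg_iff_add_eq_0)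
  have Kneg: "uminus ` K = K"
  proof -
    have "uminus ` K = (*\<^sub>R) r ` (uminus ` P)" by (simp add: K_def image_image)
    then show ?thesis by (simp add: P(2) K_def)
  qed
  have Kle: "\<nu> $ k \<bullet> x \<le> r * c" if "x \<in> K" for k x
    using that bound[of _ k] r by (auto simp: K_def)
  have Kge: "- (r * c) \<le> \<nu> $ k \<bullet> x" if "x \<in> K" for k x
  proof -
    have "- x \<in> K" using that Kneg by blast
    from Kle[OF this, of k] show ?thesis by simp
  qed
  have facetK: "facet_point K (s *\<^sub>R r *\<^sub>R \<mu> $ k) (s *\<^sub>R \<nu> $ k)" if "s \<in> {1, -1 :: real}" for s k
  proof -
    have *: "facet_point K (r *\<^sub>R \<mu> $ k) (\<nu> $ k)"
      unfolding K_def by (rule facet_point_scale[OF facet r])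
    from that show ?thesis
    proof
      assume "s = 1" then show ?thesis using * by simp
    next
      assume "s \<in> {-1}" then show ?thesis using facet_point_uminus[OF *] by (simp add: Kneg)
    qed
  qed
  have nz: "\<nu> $ k \<noteq> 0" for k using dot(1)[of k] c by auto
  \<comment> \<open>\<open>K\<close> has width at most \<open>2 * (r * c)\<close> along
    \<open>\<nu> $ k\<close>, so a shift of this size separates the copies.\<close>
  have sep: "interior K \<inter> interior ((\<lambda>x. w + x) ` K) = {}" if "\<bar>\<nu> $ k \<bullet> w\<bar> \<ge> 2 * (r * c)" for w k
  proof (cases "\<nu> $ k \<bullet> w \<ge> 0")
    case True
    show ?thesis
      by (rule interior_disjoint_if_separated[where n = "\<nu> $ k" and c = "r * c"])
         (use Kle Kge[of _ k] that True nz in \<open>fastforce simp: inner_add_right\<close>)+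
  next
    case False
    have "- \<nu> $ k \<bullet> x \<le> r * c" if "x \<in> K" for x using Kge[OF that, of k] by simp
    moreover have "r * c \<le> - \<nu> $ k \<bullet> x" if "x \<in> (\<lambda>x. w + x) ` K" for x
      using that Kle[of _ k] \<open>\<bar>\<nu> $ k \<bullet> w\<bar> \<ge> 2 * (r * c)\<close> False
      by (fastforce simp: inner_add_right)
    ultimately show ?thesis
      by (rule interior_disjoint_if_separated) (use nz in auto)
  qed
  show ?thesis
  proof (rule interlocking_layer_exists[where F = "{K}" and u = u and v = v])
    fix A assume "A \<in> {K}"
    moreover have "polytope K" unfolding K_def by (rule polytope_scaling[OF P(1)])
    moreover have "interior K \<noteq> {}"
      using facet_point_interior_nonempty[OF facetK[of 1 1]] nz by simp
    ultimately show "polytope A \<and> interior A \<noteq> {} \<and> congruent_sets T A" using T K_def by simp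
  next
    show "cross3 u v \<noteq> 0"
    proof
      assume "cross3 u v = 0"
      then have "collinear {0, u, v}" by (simp add: cross_eq_0)
      then consider "u = 0" | "v = 0" | q where "v = q *\<^sub>R u" by (auto simp: collinear_lemma)
      then show False
      proof cases
        case 1 then show False using dot(1)[of 1] r c by (auto simp: u_def)
      next
        case 2 then show False using dot(1)[of 2] r c by (auto simp: v_def)
      next
        case 3
        have "\<nu> $ 1 \<bullet> v = q * (\<nu> $ 1 \<bullet> u)" "\<nu> $ 2 \<bullet> v = q * (\<nu> $ 2 \<bullet> u)" by (simp_all add: 3)
        then have "- (r * c) = q * (2 * (r * c))" "2 * (r * c) = q * (- (r * c))"
          using dot by (simp_all add: u_def v_def)
        \<comment> \<open>Otherwise \<open>q\<close> would be both -1/2 and -2.\<close>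
        then have "r * c = 0" by algebra
        then show False using r c by simp
      qed
    qed
  next
    fix A B w assume AB: "A \<in> {K}" "B \<in> {K}" "w \<in> lattice2 u v" "(\<lambda>x. w + x) ` B \<noteq> A"
    obtain i j where w: "w = of_int i *\<^sub>R u + of_int j *\<^sub>R v" using AB(3) by (auto simp: lattice2_def)
    have "i \<noteq> 0 \<or> j \<noteq> 0" using AB w by auto
    then have *: "\<bar>2 * i - j\<bar> \<ge> 2 \<or> \<bar>2 * j - i\<bar> \<ge> 2 \<or> \<bar>i + j\<bar> \<ge> 2" by (rule three_vector_lattice_large)
    have \<nu>w: "\<nu> $ 1 \<bullet> w = of_int (2 * i - j) * (r * c)" "\<nu> $ 2 \<bullet> w = of_int (2 * j - i) * (r * c)"
      "\<nu> $ 3 \<bullet> w = - of_int (i + j) * (r * c)"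
      using dot by (simp_all add: w u_def v_def inner_add_right algebra_simps)
    have big: "2 * (r * c) \<le> \<bar>of_int q * (r * c)\<bar>" if "\<bar>q\<bar> \<ge> 2" for q :: int
    proof -
      have "2 \<le> \<bar>real_of_int q\<bar>" using that by linarith
      then have "2 * (r * c) \<le> \<bar>real_of_int q\<bar> * (r * c)" using r c by (intro mult_right_mono) auto
      then show ?thesis using r c by (simp add: abs_mult)
    qed
    from * have "\<exists>k. 2 * (r * c) \<le> \<bar>\<nu> $ k \<bullet> w\<bar>"
    proof (elim disjE)
      assume "2 \<le> \<bar>2 * i - j\<bar>" then show ?thesis by (intro exI[of _ 1]) (simp only: \<nu>w big)
    next
      assume "2 \<le> \<bar>2 * j - i\<bar>" then show ?thesis by (intro exI[of _ 2]) (simp only: \<nu>w big)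
    next
      assume "2 \<le> \<bar>i + j\<bar>" then show ?thesis
        using big[of "i + j"] by (intro exI[of _ 3]) (simp only: \<nu>w abs_minus_cancel mult_minus_left)
    qed
    then show "interior A \<inter> interior ((\<lambda>x. w + x) ` B) = {}" using sep AB by blast
  next
    fix A assume A: "A \<in> {K}"
    \<comment> \<open>There are six contacts: \<open>k\<close> selects a pair of opposite facets and
      the sign selects one of the two.\<close>
    define I where "I = (UNIV :: 3 set) \<times> {1, -1 :: real}"
    define m where "m = (\<lambda>(k :: 3, s :: real). s *\<^sub>R r *\<^sub>R \<mu> $ k)"
    define n where "n = (\<lambda>(k :: 3, s :: real). s *\<^sub>R \<nu> $ k)"
    have sumI: "(\<Sum>i\<in>I. h i) = (\<Sum>k\<in>UNIV. h (k, 1) + h (k, -1))" for h :: "3 \<times> real \<Rightarrow> 'b::comm_monoid_add"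
      unfolding I_def sum.cartesian_product[symmetric, of "\<lambda>k s. h (k, s)", simplified] by simp
    have "balanced I m n"
      unfolding balanced_def
    proof (intro conjI allI impI)
      show "finite I" by (simp add: I_def)
      show "(\<Sum>i\<in>I. n i) = 0" by (simp add: sumI n_def)
      show "v = 0" if "\<forall>i\<in>I. n i \<bullet> v = 0" for v
      proof (rule sp)
        fix k
        have "(k, 1) \<in> I" by (simp add: I_def)
        then show "\<nu> $ k \<bullet> v = 0" using that by (force simp: n_def)
      qed
      fix f :: "real^3 \<Rightarrow> real^3" assume f: "linear f \<and> (\<forall>x. f x \<bullet> x = 0)"
      then have lf: "linear f" and sf: "x \<bullet> f x = 0" for x by (auto simp: inner_commute)
      have "(\<Sum>i\<in>I. n i \<bullet> f (m i)) = (\<Sum>k\<in>UNIV. 2 * r * (\<nu> $ k \<bullet> f (\<mu> $ k)))"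
        unfolding sumI by (simp add: n_def m_def linear_scale[OF lf] linear_neg[OF lf] mult.assoc)
      \<comment> \<open>Skewness removes the \<open>\<kappa>\<close> terms, and linearity collects
        the rest at the sum of the contact points.\<close>
      also have "\<dots> = 2 * r * (e \<bullet> f (\<mu> $ 1 + \<mu> $ 2 + \<mu> $ 3))"
        by (simp add: \<nu>\<mu> inner_add_left sf sum_3 linear_add[OF lf] inner_add_right algebra_simps)
      also have "\<dots> = 0" by (simp add: \<mu>0 linear_0[OF lf])
      finally show "(\<Sum>i\<in>I. n i \<bullet> f (m i)) = 0" .
    qed
    moreover have "facet_point A (m i) (n i) \<and> (\<exists>B\<in>{K}. \<exists>w\<in>lattice2 u v.
         (\<lambda>x. w + x) ` B \<noteq> A \<and> facet_point ((\<lambda>x. w + x) ` B) (m i) (- n i))" if "i \<in> I" for i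
    proof -
      obtain k s where i: "i = (k, s)" and s: "s \<in> {1, -1 :: real}" using \<open>i \<in> I\<close> by (auto simp: I_def)
      let ?p = "s *\<^sub>R r *\<^sub>R \<mu> $ k"
      let ?w = "2 *\<^sub>R ?p"
      have mi: "m i = ?p" and ni: "n i = s *\<^sub>R \<nu> $ k" by (simp_all add: i m_def n_def)
      define z :: int where "z = (if s = 1 then 1 else -1)"
      have z: "s = of_int z" using s by (auto simp: z_def)
      have "?w \<in> lattice2 u v"
      proof -
        have "\<exists>i j :: int. ?w = of_int i *\<^sub>R u + of_int j *\<^sub>R v"
          using exhaust_3[of k]
        proof (elim disjE)
          assume "k = 1" then show ?thesis
            by (intro exI[of _ z] exI[of _ 0]) (simp add: u_def z mult_ac)
        next
          assume "k = 2" then show ?thesis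
            by (intro exI[of _ 0] exI[of _ z]) (simp add: v_def z mult_ac)
        next
          assume "k = 3" then show ?thesis
            by (intro exI[of _ "- z"]) (simp add: u_def v_def z \<mu>3 algebra_simps)
        qed
        then show ?thesis by (simp add: lattice2_def)
      qed
      \<comment> \<open>The translate contains three times \<open>?p\<close>, where
        \<open>\<nu> $ k\<close> exceeds its bound on \<open>K\<close>.\<close>
      moreover have "(\<lambda>x. ?w + x) ` K \<noteq> K"
      proof
        assume "(\<lambda>x. ?w + x) ` K = K"
        moreover have "?p \<in> K" by (rule facet_point_mem[OF facetK[OF s]])
        ultimately have "?w + ?p \<in> K" by blast
        then have "\<bar>\<nu> $ k \<bullet> (?w + ?p)\<bar> \<le> r * c" using Kle Kge by (simp add: abs_le_iff minus_le_iff)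
        moreover have "\<nu> $ k \<bullet> (?w + ?p) = 3 * s * (r * c)" by (simp add: inner_add_right dot)
        moreover have "\<bar>3 * s * (r * c)\<bar> = 3 * (r * c)" using s r c by auto
        ultimately show False using r c by (simp add: mult_le_0_iff)
      qed
      moreover have "facet_point ((\<lambda>x. ?w + x) ` K) ?p (- (s *\<^sub>R \<nu> $ k))"
      proof -
        have "facet_point K (- ?p) (- (s *\<^sub>R \<nu> $ k))"
          using facet_point_uminus[OF facetK[OF s, of k]] by (simp add: Kneg)
        moreover have "?w + (- ?p) = ?p" by (simp only: scaleR_2) simp
        ultimately show ?thesis using facet_point_translate[of K "- ?p" _ ?w] by metis
      qed
      ultimately show ?thesis using facetK[OF s, of k] A unfolding mi ni by blast
    qed
    ultimately show "\<exists>(I :: (3 \<times> real) set) m n. balanced I m n \<and>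
      (\<forall>i\<in>I. facet_point A (m i) (n i) \<and> (\<exists>B\<in>{K}. \<exists>w\<in>lattice2 u v.
         (\<lambda>x. w + x) ` B \<noteq> A \<and> facet_point ((\<lambda>x. w + x) ` B) (m i) (- n i)))"
      by blast
  qed simp_all
qed

section \<open>Facets of convex hulls\<close>

lemma inner_vector_3: "(vector [a, b, c] :: real^3) \<bullet> x = a * x $ 1 + b * x $ 2 + c * x $ 3"
  by (simp add: inner_vec_def sum_3)

lemma vector_3_eq_iff:
  "(vector [a, b, c] :: 'a::zero^3) = vector [a', b', c'] \<longleftrightarrow> a = a' \<and> b = b' \<and> c = c'"
  by (simp add: vec_eq_iff forall_3)

lemma vector_3_uminus: "- (vector [a, b, c] :: real^3) = vector [- a, - b, - c]"
  by (simp add: vec_eq_iff forall_3)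

lemma convex_hull_inner_le:
  assumes "\<And>v. v \<in> V \<Longrightarrow> n \<bullet> v \<le> c" "x \<in> convex hull V"
  shows "n \<bullet> x \<le> c"
proof -
  have "convex hull V \<subseteq> {x. n \<bullet> x \<le> c}"
    using assms(1) by (intro hull_minimal convex_halfspace_le) auto
  then show ?thesis using assms(2) by blast
qed

lemma convex_hull_uminus_eq:
  fixes V :: "'a::real_vector set"
  assumes "\<And>v. v \<in> V \<Longrightarrow> - v \<in> V"
  shows "uminus ` (convex hull V) = convex hull V"
proof -
  have "uminus ` V = V" using assms by force
  then show ?thesis by (metis convex_hull_linear_image linear_uminus)
qed

text \<open>Since \<open>p\<close>, \<open>q\<close>, \<open>s\<close> are linearly independent,
  they give coordinates that stay positive near \<open>m\<close>. The half-space condition says that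
  their sum is at most 1, and the missing weight goes to the point 0 of \<open>K\<close>.\<close>

lemma facet_point_triangle:
  assumes K: "convex K" "0 \<in> K" "p \<in> K" "q \<in> K" "s \<in> K"
    and n: "n \<bullet> p = c" "n \<bullet> q = c" "n \<bullet> s = c" and c: "c > 0"
    and a: "\<alpha> > 0" "\<beta> > 0" "\<gamma> > 0" "\<alpha> + \<beta> + \<gamma> = 1"
    and m: "m = \<alpha> *\<^sub>R p + \<beta> *\<^sub>R q + \<gamma> *\<^sub>R s"
    and D: "p \<bullet> cross3 q s \<noteq> 0"
  shows "facet_point K m n"
proof -
  let ?D = "p \<bullet> cross3 q s"
  \<comment> \<open>Cramer's rule\<close>
  define f where "f x = x \<bullet> cross3 q s / ?D" for x
  define g where "g x = x \<bullet> cross3 s p / ?D" for x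
  define h where "h x = x \<bullet> cross3 p q / ?D" for x
  have rep: "x = f x *\<^sub>R p + g x *\<^sub>R q + h x *\<^sub>R s" for x
  proof -
    have "?D *\<^sub>R x = (x \<bullet> cross3 q s) *\<^sub>R p + (x \<bullet> cross3 s p) *\<^sub>R q + (x \<bullet> cross3 p q) *\<^sub>R s"
      by (simp add: cross3_simps forall_3 vec_eq_iff inner_vec_def sum_3 cross3_def)
    then have "(1 / ?D) *\<^sub>R (?D *\<^sub>R x) = (1 / ?D) *\<^sub>R \<dots>" by simp
    then show ?thesis using D by (simp add: f_def g_def h_def scaleR_add_right)
  qed
  have zero: "q \<bullet> cross3 q s = 0" "s \<bullet> cross3 q s = 0" "p \<bullet> cross3 s p = 0" "s \<bullet> cross3 s p = 0"
    "p \<bullet> cross3 p q = 0" "q \<bullet> cross3 p q = 0" "q \<bullet> cross3 s p = ?D" "s \<bullet> cross3 p q = ?D"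
    by (simp_all add: inner_vec_def sum_3 cross3_def algebra_simps)
  have fm: "f m = \<alpha>" "g m = \<beta>" "h m = \<gamma>"
    using D by (simp_all add: f_def g_def h_def m inner_add_left zero)
  have "open {x. 0 < f x \<and> 0 < g x \<and> 0 < h x}"
    unfolding f_def g_def h_def using D by (intro open_Collect_conj open_Collect_less continuous_intros) auto
  moreover have "m \<in> {x. 0 < f x \<and> 0 < g x \<and> 0 < h x}" using fm a by simp
  ultimately obtain \<epsilon> where \<epsilon>: "\<epsilon> > 0" "ball m \<epsilon> \<subseteq> {x. 0 < f x \<and> 0 < g x \<and> 0 < h x}"
    using open_contains_ball by blast
  have "x \<in> K" if x: "x \<in> ball m \<epsilon>" "n \<bullet> x \<le> n \<bullet> m" for x
  proof -
    have pos: "0 < f x" "0 < g x" "0 < h x" using \<epsilon>(2) x(1) by auto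
    let ?S = "f x + g x + h x"
    have "n \<bullet> x = ?S * c"
      by (subst rep[of x]) (simp add: inner_add_right n algebra_simps)
    moreover have "n \<bullet> m = (\<alpha> + \<beta> + \<gamma>) * c" by (simp add: m inner_add_right n algebra_simps)
    ultimately have S: "?S \<le> 1" using x(2) a(4) c by simp
    have "x = (\<Sum>i\<in>{0,1,2,3::nat}. ([f x, g x, h x, 1 - ?S] ! i) *\<^sub>R ([p, q, s, 0] ! i))"
      using rep[of x] by (simp add: add.assoc)
    also have "\<dots> \<in> K"
      using K pos S by (intro convex_sum) auto
    finally show ?thesis .
  qed
  with \<epsilon>(1) show ?thesis by (auto simp: facet_point_def)
qed

section \<open>The five solids\<close>

lemma Collect_signs:
  "{F s | s. s \<in> {-1, 1 :: real}} = {F (-1), F 1}"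
  "{G s t | s t. s \<in> {-1, 1 :: real} \<and> t \<in> {-1, 1 :: real}} =
     {G (-1) (-1), G (-1) 1, G 1 (-1), G 1 1}"
  "{H x y z | x y z. x \<in> {-1, 1 :: real} \<and> y \<in> {-1, 1 :: real} \<and> z \<in> {-1, 1 :: real}} =
     {H (-1) (-1) (-1), H (-1) (-1) 1, H (-1) 1 (-1), H (-1) 1 1,
      H 1 (-1) (-1), H 1 (-1) 1, H 1 1 (-1), H 1 1 1}"
  by blast+

section \<open>Arithmetic of the golden ratio\<close>

lemma golden_ratio_gt_1: "golden_ratio > 1"
  using real_less_rsqrt[of 1 5] by (simp add: golden_ratio_def)

lemma golden_ratio_less_2: "golden_ratio < 2"
  using real_less_lsqrt[of 3 5] by (simp add: golden_ratio_def)

lemma golden_ratio_mult_self: "golden_ratio * golden_ratio = golden_ratio + 1"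
  by (simp add: golden_ratio_def field_simps)

text \<open>This form matches right-nested products, so that rewriting lowers every polynomial in
  \<open>golden_ratio\<close> to degree at most one.\<close>

lemma golden_ratio_mult_self_left: "golden_ratio * (golden_ratio * x) = (golden_ratio + 1) * x"
  by (metis golden_ratio_mult_self mult.assoc)

text \<open>The inverse of the golden ratio is itself minus 1, which makes the dodecahedron
  coordinates polynomial.\<close>

lemma divide_golden_ratio: "t / golden_ratio = t * (golden_ratio - 1)"
  using golden_ratio_gt_1 by (simp add: field_simps golden_ratio_mult_self golden_ratio_mult_self_left)

lemmas golden_simps = golden_ratio_mult_self golden_ratio_mult_self_left algebra_simps


text \<open>The inverse congruence undoes the orthogonal part and the translation, leaving only the
  scale.\<close>

lemma congruent_sets_if_similar_sets:
  assumes "similar_sets P T"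
  obtains r where "r > 0" "congruent_sets T ((*\<^sub>R) r ` P)"
proof -
  obtain r c and Q :: "real^3^3" where r: "r > 0" and Q: "orthogonal_matrix Q"
    and T: "T = (\<lambda>x. r *\<^sub>R (Q *v x) + c) ` P"
    using assms by (auto simp: similar_sets_def)
  let ?c = "- (transpose Q *v c)"
  have QQ: "transpose Q *v (Q *v x) = x" for x
    using Q by (simp add: matrix_vector_mul_assoc orthogonal_matrix_def del: transpose_matrix_vector)
  have "(\<lambda>y. transpose Q *v y + ?c) ` T = (*\<^sub>R) r ` P"
    unfolding T image_image
    by (intro image_cong refl)
       (simp add: matrix_vector_right_distrib matrix_vector_mult_scaleR QQ del: transpose_matrix_vector)
  moreover have "orthogonal_matrix (transpose Q)" using Q by (simp add: orthogonal_matrix_transpose)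
  ultimately show ?thesis using r that unfolding congruent_sets_def by metis
qed

text \<open>The rows of \<open>p\<close>, \<open>q\<close>, \<open>s\<close> are vertices, three on each of the facets with normals
  \<open>\<nu> $ k\<close>; the contact points \<open>\<mu> $ k\<close> lie inside the triangles that they span.\<close>

lemma hexagonal_layer_of_vertices:
  fixes V :: "(real^3) set" and \<mu> \<nu> p q s :: "real^3^3"
  assumes V: "finite V" "\<forall>v\<in>V. - v \<in> V"
    and bound: "\<forall>k. \<forall>v\<in>V. \<nu> $ k \<bullet> v \<le> c" and c: "c > 0"
    and dot: "\<forall>k. \<nu> $ k \<bullet> \<mu> $ k = c" "\<forall>j k. j \<noteq> k \<longrightarrow> \<nu> $ k \<bullet> \<mu> $ j = - c / 2"
    and \<mu>0: "\<mu> $ 1 + \<mu> $ 2 + \<mu> $ 3 = 0"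
    and \<nu>\<mu>: "\<forall>k. \<nu> $ k = \<kappa> *\<^sub>R \<mu> $ k + e"
    and sp: "\<And>v. \<forall>k. \<nu> $ k \<bullet> v = 0 \<Longrightarrow> v = 0"
    and vert: "\<forall>k. p $ k \<in> V \<and> q $ k \<in> V \<and> s $ k \<in> V"
    and on: "\<forall>k. \<nu> $ k \<bullet> p $ k = c \<and> \<nu> $ k \<bullet> q $ k = c \<and> \<nu> $ k \<bullet> s $ k = c"
    and pos: "\<alpha> > 0" "\<beta> > 0" "\<gamma> > 0" "\<alpha> + \<beta> + \<gamma> = 1"
    and \<mu>: "\<forall>k. \<mu> $ k = \<alpha> *\<^sub>R p $ k + \<beta> *\<^sub>R q $ k + \<gamma> *\<^sub>R s $ k"
    and D: "\<forall>k. p $ k \<bullet> cross3 (q $ k) (s $ k) \<noteq> 0"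
    and T: "similar_sets (convex hull V) T"
  shows "\<exists>n a b L. is_layer n a b L \<and> (\<forall>A\<in>L. congruent_sets T A) \<and> full_interlocking n a b L"
proof -
  obtain r where r: "r > 0" "congruent_sets T ((*\<^sub>R) r ` (convex hull V))"
    using congruent_sets_if_similar_sets[OF T] .
  have zero: "0 \<in> convex hull V"
  proof -
    have "p $ 1 \<in> convex hull V" "- p $ 1 \<in> convex hull V" using vert V(2) by (simp_all add: hull_inc)
    then have "(1/2) *\<^sub>R p $ 1 + (1/2) *\<^sub>R (- p $ 1) \<in> convex hull V"
      by (intro convexD[OF convex_convex_hull]) auto
    then show ?thesis by simp
  qed
  show ?thesis
  proof (rule hexagonal_layer_exists[OF _ _ _ c _ _ \<mu>0 _ _ _ r])
    show "polytope (convex hull V)" by (rule polytope_convex_hull[OF V(1)])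
    show "uminus ` (convex hull V) = convex hull V" using V(2) by (intro convex_hull_uminus_eq) blast
    fix k
    show "facet_point (convex hull V) (\<mu> $ k) (\<nu> $ k)"
    proof (rule facet_point_triangle[OF convex_convex_hull zero _ _ _ _ _ _ c pos])
      show "p $ k \<in> convex hull V" "q $ k \<in> convex hull V" "s $ k \<in> convex hull V"
        using vert by (simp_all add: hull_inc)
      show "\<nu> $ k \<bullet> p $ k = c" "\<nu> $ k \<bullet> q $ k = c" "\<nu> $ k \<bullet> s $ k = c"
        using on by simp_all
      show "\<mu> $ k = \<alpha> *\<^sub>R p $ k + \<beta> *\<^sub>R q $ k + \<gamma> *\<^sub>R s $ k" using \<mu> by simp
      show "p $ k \<bullet> cross3 (q $ k) (s $ k) \<noteq> 0" using D by (rule spec)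
    qed
    show "\<nu> $ k \<bullet> x \<le> c" if "x \<in> convex hull V" for x
      using bound by (intro convex_hull_inner_le[OF _ that]) simp
    show "\<nu> $ k \<bullet> \<mu> $ k = c" "\<nu> $ k = \<kappa> *\<^sub>R \<mu> $ k + e" using dot(1) \<nu>\<mu> by simp_all
    show "\<nu> $ k \<bullet> \<mu> $ j = - c / 2" if "j \<noteq> k" for j using dot(2) that by simp
  qed (rule sp, simp)
qed

section \<open>Facet data of the four centrally symmetric solids\<close>

lemmas vector_3_simps = forall_3 inner_vector_3 vector_3_eq_iff vector_3_uminus vec_eq_iff[of _ "_ :: real^3"] cross3_def

text \<open>The axis is the diagonal (1, 1, 1). \<open>e\<close> is the component of each normal
  along it, and \<open>\<mu> $ k\<close> is the projection of the normal orthogonal to it, stretched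
  by 3/2 to reach the facet plane.\<close>

lemma cube_layer:
  assumes "similar_sets std_cube T"
  shows "\<exists>n a b L. is_layer n a b L \<and> (\<forall>A\<in>L. congruent_sets T A) \<and> full_interlocking n a b L"
  by (rule hexagonal_layer_of_vertices[OF _ _ _ _ _ _ _ _ _ _ _ _ _ _ _ _ _ assms[unfolded std_cube_def Collect_signs],
    where c = 1 and \<kappa> = "2/3" and e = "vector [1/3, 1/3, 1/3]" and \<alpha> = "1/2" and \<beta> = "1/4" and \<gamma> = "1/4"
      and \<mu> = "vector [vector [1, -1/2, -1/2], vector [-1/2, 1, -1/2], vector [-1/2, -1/2, 1]]"
      and \<nu> = "vector [vector [1, 0, 0], vector [0, 1, 0], vector [0, 0, 1]]"
      and p = "vector [vector [1, -1, -1], vector [-1, 1, -1], vector [-1, -1, 1]]"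
      and q = "vector [vector [1, 1, -1], vector [-1, 1, 1], vector [1, -1, 1]]"
      and s = "vector [vector [1, -1, 1], vector [1, 1, -1], vector [-1, 1, 1]]"])
    (simp_all add: vector_3_simps)

text \<open>The three facets are those sharing an edge with the facet orthogonal to the axis (1, 1,
  1).\<close>

lemma octahedron_layer:
  assumes "similar_sets std_octahedron T"
  shows "\<exists>n a b L. is_layer n a b L \<and> (\<forall>A\<in>L. congruent_sets T A) \<and> full_interlocking n a b L"
  by (rule hexagonal_layer_of_vertices[OF _ _ _ _ _ _ _ _ _ _ _ _ _ _ _ _ _ assms[unfolded std_octahedron_def Collect_signs],
    where c = 1 and \<kappa> = "8/3" and e = "vector [1/3, 1/3, 1/3]" and \<alpha> = "1/2" and \<beta> = "1/4" and \<gamma> = "1/4"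
      and \<mu> = "vector [vector [-1/2, 1/4, 1/4], vector [1/4, -1/2, 1/4], vector [1/4, 1/4, -1/2]]"
      and \<nu> = "vector [vector [-1, 1, 1], vector [1, -1, 1], vector [1, 1, -1]]"
      and p = "vector [vector [-1, 0, 0], vector [0, -1, 0], vector [0, 0, -1]]"
      and q = "vector [vector [0, 1, 0], vector [0, 0, 1], vector [1, 0, 0]]"
      and s = "vector [vector [0, 0, 1], vector [1, 0, 0], vector [0, 1, 0]]"])
    (simp_all add: vector_3_simps)

text \<open>Going once round the cycle multiplies \<open>x\<close> by the cube of the golden ratio,
  which exceeds 1. This is the spanning condition for the dodecahedron normals.\<close>

lemma golden_cycle:
  assumes "golden_ratio * z = y \<and> golden_ratio * x = z \<and> golden_ratio * y = x"
  shows "x = 0 \<and> y = 0 \<and> z = 0"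
proof -
  have "x = golden_ratio * (golden_ratio * (golden_ratio * x))" by (simp add: assms)
  also have "\<dots> = (2 * golden_ratio + 1) * x" by (simp add: golden_simps)
  finally have "x = 0" using golden_ratio_gt_1 by (simp add: algebra_simps)
  then show ?thesis using assms by auto
qed

text \<open>Eight facets have the normals of the octahedron, so its data are reused with
  \<open>c\<close> and \<open>\<mu>\<close> scaled by \<open>?g + 1\<close>, whose inverse is
  \<open>2 - ?g\<close>. Only the vertices and weights differ.\<close>

lemma icosahedron_layer:
  assumes "similar_sets std_icosahedron T"
  shows "\<exists>n a b L. is_layer n a b L \<and> (\<forall>A\<in>L. congruent_sets T A) \<and> full_interlocking n a b L"
proof -
  let ?g = golden_ratio
  show ?thesis
    by (rule hexagonal_layer_of_vertices[OF _ _ _ _ _ _ _ _ _ _ _ _ _ _ _ _ _ assms[unfolded std_icosahedron_def Collect_signs],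
    where c = "?g + 1" and \<kappa> = "8/3 * (2 - ?g)" and e = "vector [1/3, 1/3, 1/3]"
      and \<alpha> = "(2 - ?g) / 8" and \<beta> = "(?g + 3) / 8" and \<gamma> = "3/8"
      and \<mu> = "vector [vector [-(?g + 1)/2, (?g + 1)/4, (?g + 1)/4],
        vector [(?g + 1)/4, -(?g + 1)/2, (?g + 1)/4], vector [(?g + 1)/4, (?g + 1)/4, -(?g + 1)/2]]"
      and \<nu> = "vector [vector [-1, 1, 1], vector [1, -1, 1], vector [1, 1, -1]]"
      and p = "vector [vector [0, 1, ?g], vector [?g, 0, 1], vector [1, ?g, 0]]"
      and q = "vector [vector [-?g, 0, 1], vector [1, -?g, 0], vector [0, 1, -?g]]"
      and s = "vector [vector [-1, ?g, 0], vector [0, -1, ?g], vector [?g, 0, -1]]"])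
    (use golden_ratio_gt_1 golden_ratio_less_2 in
      \<open>simp_all add: vector_3_simps golden_simps field_simps\<close>)
qed

text \<open>The normals are cyclic permutations of one vector, and \<open>e\<close> is their common
  component along (1, 1, 1). Three of the five vertices of each pentagon span a triangle around the
  contact point.\<close>

lemma dodecahedron_layer:
  assumes "similar_sets std_dodecahedron T"
  shows "\<exists>n a b L. is_layer n a b L \<and> (\<forall>A\<in>L. congruent_sets T A) \<and> full_interlocking n a b L"
proof -
  let ?g = golden_ratio
  show ?thesis
    by (rule hexagonal_layer_of_vertices[OF _ _ _ _ _ _ _ _ _ _ _ _ _ _ _ _ _ assms[unfolded std_dodecahedron_def Collect_signs divide_golden_ratio],
    where c = "?g + 1" and \<kappa> = "4/3" and e = "vector [(?g - 1)/3, (?g - 1)/3, (?g - 1)/3]"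
      and \<alpha> = "1/2" and \<beta> = "?g / 4" and \<gamma> = "(2 - ?g)/4"
      and \<mu> = "vector [vector [(1 - ?g)/4, -(2 + ?g)/4, (2 * ?g + 1)/4],
        vector [(2 * ?g + 1)/4, (1 - ?g)/4, -(2 + ?g)/4], vector [-(2 + ?g)/4, (2 * ?g + 1)/4, (1 - ?g)/4]]"
      and \<nu> = "vector [vector [0, -1, ?g], vector [?g, 0, -1], vector [-1, ?g, 0]]"
      and p = "vector [vector [-1, -1, 1], vector [1, -1, -1], vector [-1, 1, -1]]"
      and q = "vector [vector [1, -1, 1], vector [1, 1, -1], vector [-1, 1, 1]]"
      and s = "vector [vector [1 - ?g, 0, ?g], vector [?g, 1 - ?g, 0], vector [0, ?g, 1 - ?g]]"])
    (use golden_ratio_gt_1 golden_ratio_less_2 in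
      \<open>simp_all add: vector_3_simps golden_simps field_simps\<close>, erule golden_cycle)
qed

section \<open>The tetrahedron\<close>

lemma vector_3_scale: "r *\<^sub>R (vector [a, b, c] :: real^3) = vector [r * a, r * b, r * c]"
  by (simp add: vec_eq_iff forall_3)

text \<open>The contact points are the midpoints of the sides of the square section at height 0, one
  on each facet. Reflecting \<open>K\<close> in a contact point gives the neighbour there.\<close>

lemma tetrahedron_layer:
  assumes "similar_sets std_tetrahedron T"
  shows "\<exists>n a b L. is_layer n a b L \<and> (\<forall>A\<in>L. congruent_sets T A) \<and> full_interlocking n a b L"
proof -
  obtain r where r: "r > 0" and T: "congruent_sets T ((*\<^sub>R) r ` std_tetrahedron)"
    using congruent_sets_if_similar_sets[OF assms] .
  let ?V = "{vector [1, 1, 1], vector [1, -1, -1], vector [-1, 1, -1], vector [-1, -1, 1]} :: (real^3) set"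
  define K where "K = (*\<^sub>R) r ` std_tetrahedron"
  define \<nu> where "\<nu> = (\<lambda>(s, t). vector [s, t, - s * t] :: real^3)"
  define \<mu> where "\<mu> = (\<lambda>(s, t). vector [r * s / 2, r * t / 2, 0] :: real^3)"
  define I where "I = {1, -1 :: real} \<times> {1, -1 :: real}"
  define d where "d = (vector [r, r, 0] :: real^3)"
  \<comment> \<open>\<open>d\<close> is twice the contact point \<open>\<mu> (1, 1)\<close>, so
    \<open>K'\<close> is the neighbour of \<open>K\<close> at that point.\<close>
  define K' where "K' = (\<lambda>x. d + x) ` uminus ` K"
  define u where "u = (vector [2 * r, 0, 0] :: real^3)"
  define v where "v = (vector [0, 2 * r, 0] :: real^3)"
  have Ie: "s * s = 1" "t * t = 1" if "(s, t) \<in> I" for s t using that by (auto simp: I_def)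
  have bound: "n \<bullet> x \<le> r" if V: "\<And>v. v \<in> ?V \<Longrightarrow> n \<bullet> v \<le> 1" and x: "x \<in> K" for n x
  proof -
    obtain y where y: "y \<in> convex hull ?V" "x = r *\<^sub>R y" using x by (auto simp: K_def std_tetrahedron_def)
    have "n \<bullet> y \<le> 1" by (rule convex_hull_inner_le[OF V y(1)])
    then show ?thesis using r by (simp add: y(2))
  qed
  have b\<nu>: "\<nu> i \<bullet> x \<le> r" if "i \<in> I" "x \<in> K" for i x
    by (rule bound[OF _ that(2)]) (use that(1) in \<open>auto simp: I_def \<nu>_def inner_vector_3\<close>)
  \<comment> \<open>The tetrahedron and its negative lie in the cube of half-side \<open>r\<close>,
    so a coordinate gap of \<open>2 * r\<close> between centres separates any two copies.\<close>
  have be: "\<bar>x $ k\<bar> \<le> r" if "x \<in> K" for x k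
  proof -
    have "axis k 1 \<bullet> x \<le> r" "- axis k 1 \<bullet> x \<le> r"
      by (rule bound[OF _ that]; use exhaust_3[of k] in \<open>auto simp: inner_axis' inner_commute[of "axis _ _"]\<close>)+
    then show ?thesis by (simp add: inner_axis' abs_le_iff)
  qed
  have facet: "facet_point K (\<mu> i) (\<nu> i)" if iI: "i \<in> I" for i
  proof -
    obtain s t where i: "i = (s, t)" "(s, t) \<in> I" using iI by (cases i) auto
    let ?P = "convex hull ?V"
    have zero: "0 \<in> ?P"
    proof -
      have "(\<Sum>i\<in>{0,1,2,3::nat}. (1/4) *\<^sub>R ([vector [1, 1, 1], vector [1, -1, -1], vector [-1, 1, -1],
          vector [-1, -1, 1]] ! i)) \<in> ?P"
        by (rule convex_sum) (auto intro: hull_inc)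
      also have "(\<Sum>i\<in>{0,1,2,3::nat}. (1/4) *\<^sub>R ([vector [1, 1, 1], vector [1, -1, -1], vector [-1, 1, -1],
          vector [-1, -1, 1]] ! i)) = (0 :: real^3)"
        by (simp add: vec_eq_iff forall_3)
      finally show ?thesis .
    qed
    have "facet_point ?P (vector [s / 2, t / 2, 0]) (vector [s, t, - s * t])"
      by (rule facet_point_triangle[OF convex_convex_hull zero, where c = 1
            and p = "vector [s, t, s * t]" and q = "vector [s, - t, - s * t]"
            and s = "vector [- s, t, - s * t]" and \<alpha> = "1/2" and \<beta> = "1/4" and \<gamma> = "1/4"])
         (use i(2) in \<open>auto simp: I_def vector_3_simps intro!: hull_inc\<close>)
    from facet_point_scale[OF this r] show ?thesis
      by (simp add: K_def std_tetrahedron_def i \<mu>_def \<nu>_def vector_3_scale)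
  qed
  have intK: "interior K \<noteq> {}"
    by (rule facet_point_interior_nonempty[OF facet[of "(1, 1)"]])
       (auto simp: I_def \<nu>_def vec_eq_iff forall_3)
  have facet': "facet_point K' (d + - \<mu> i) (- \<nu> i)" if "i \<in> I" for i
    unfolding K'_def by (intro facet_point_translate facet_point_uminus facet that)
  have intK': "interior K' \<noteq> {}"
    by (rule facet_point_interior_nonempty[OF facet'[of "(1, 1)"]])
       (auto simp: I_def \<nu>_def vec_eq_iff forall_3)
  have far1: "interior ((\<lambda>x. z + x) ` A) \<inter> interior ((\<lambda>x. z' + x) ` B) = {}"
    if A: "A \<in> {K, uminus ` K}" and B: "B \<in> {K, uminus ` K}" and zz: "z' $ k \<ge> z $ k + 2 * r" for A B z z' k
  proof (rule interior_disjoint_if_separated[where n = "axis k 1" and c = "z $ k + r"])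
    have *: "x $ k \<le> r \<and> - r \<le> x $ k" if "x \<in> C" "C \<in> {K, uminus ` K}" for x C
      using that be[of _ k] by (force simp: abs_le_iff)
    show "axis k 1 \<bullet> x \<le> z $ k + r" if "x \<in> (\<lambda>x. z + x) ` A" for x
      using that *[OF _ A] by (auto simp: inner_axis')
    show "z $ k + r \<le> axis k 1 \<bullet> x" if "x \<in> (\<lambda>x. z' + x) ` B" for x
      using that *[OF _ B] zz by (force simp: inner_axis')
  qed (simp add: axis_eq_0_iff)
  have far: "interior ((\<lambda>x. z + x) ` A) \<inter> interior ((\<lambda>x. z' + x) ` B) = {}"
    if A: "A \<in> {K, uminus ` K}" and B: "B \<in> {K, uminus ` K}" and zz: "\<bar>z' $ k - z $ k\<bar> \<ge> 2 * r" for A B z z' k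
  proof (cases "z' $ k \<ge> z $ k")
    case True
    then show ?thesis using zz by (intro far1[OF A B, of _ k]) auto
  next
    case False
    then show ?thesis using zz by (subst Int_commute, intro far1[OF B A, of _ k]) auto
  qed
  have same: "interior ((\<lambda>x. z + x) ` A) \<inter> interior ((\<lambda>x. z' + x) ` A) = {}"
    if "A \<in> {K, uminus ` K}" "z' - z = vector [2 * r * of_int i, 2 * r * of_int j, 0]" "z' \<noteq> z" for A z z' i j
  proof -
    have ij: "z' $ 1 - z $ 1 = 2 * r * of_int i" "z' $ 2 - z $ 2 = 2 * r * of_int j"
      using arg_cong[OF that(2), of "\<lambda>x. x $ 1"] arg_cong[OF that(2), of "\<lambda>x. x $ 2"] by simp_all
    have big: "2 * r \<le> \<bar>2 * r * of_int n\<bar>" if "n \<noteq> 0" for n :: int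
    proof -
      have "1 \<le> \<bar>real_of_int n\<bar>" using that by linarith
      then show ?thesis using r by (simp add: abs_mult)
    qed
    have "i \<noteq> 0 \<or> j \<noteq> 0"
    proof (rule ccontr)
      assume "\<not> ?thesis"
      then have "z' - z = 0" by (simp add: that(2) vec_eq_iff forall_3)
      then show False using that(3) by simp
    qed
    then show ?thesis
    proof
      assume "i \<noteq> 0" then show ?thesis using far[OF that(1) that(1), of z' 1 z] big ij by metis
    next
      assume "j \<noteq> 0" then show ?thesis using far[OF that(1) that(1), of z' 2 z] big ij by metis
    qed
  qed
  have near: "interior ((\<lambda>x. z + x) ` K) \<inter> interior ((\<lambda>x. z' + x) ` uminus ` K) = {}"
    if i: "i \<in> I" and zz: "z' = z + 2 *\<^sub>R \<mu> i" for z z' i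
  proof (rule interior_disjoint_if_separated[where n = "\<nu> i" and c = "\<nu> i \<bullet> z + r"])
    have "\<nu> i \<bullet> \<mu> i = r"
      using i by (auto simp: I_def \<nu>_def \<mu>_def inner_vector_3)
    then have z': "\<nu> i \<bullet> z' = \<nu> i \<bullet> z + 2 * r" by (simp add: zz inner_add_right)
    show "\<nu> i \<bullet> x \<le> \<nu> i \<bullet> z + r" if "x \<in> (\<lambda>x. z + x) ` K" for x
      using that b\<nu>[OF i] by (auto simp: inner_add_right)
    show "\<nu> i \<bullet> z + r \<le> \<nu> i \<bullet> x" if x: "x \<in> (\<lambda>x. z' + x) ` uminus ` K" for x
    proof -
      obtain y where "y \<in> K" "x = z' - y" using x by auto
      then show ?thesis using b\<nu>[OF i, of y] z' by (simp add: inner_diff_right)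
    qed
    show "\<nu> i \<noteq> 0" using i by (auto simp: I_def \<nu>_def vec_eq_iff forall_3)
  qed
  have opposite: "interior ((\<lambda>x. z + x) ` K) \<inter> interior ((\<lambda>x. z' + x) ` uminus ` K) = {}"
    if zz: "z' - z = vector [r * of_int a, r * of_int b, 0]" and odd: "odd a" "odd b" for z z' a b
  proof -
    have ab: "z' $ 1 - z $ 1 = r * of_int a" "z' $ 2 - z $ 2 = r * of_int b"
      using arg_cong[OF zz, of "\<lambda>x. x $ 1"] arg_cong[OF zz, of "\<lambda>x. x $ 2"] by simp_all
    have big: "2 * r \<le> \<bar>r * of_int n\<bar>" if "\<bar>n\<bar> \<ge> 2" for n :: int
    proof -
      have "2 \<le> \<bar>real_of_int n\<bar>" using that by linarith
      then have "r * 2 \<le> r * \<bar>real_of_int n\<bar>" using r by (intro mult_left_mono) auto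
      then show ?thesis using r by (simp add: abs_mult)
    qed
    \<comment> \<open>Either a coordinate plane separates the two copies, or they are neighbours
      separated by a common facet plane.\<close>
    consider "\<bar>a\<bar> \<ge> 2" | "\<bar>b\<bar> \<ge> 2" | "a \<in> {1, -1}" "b \<in> {1, -1}"
      using odd by (cases "a = 0"; cases "b = 0"; auto; linarith)
    then show ?thesis
    proof cases
      case 1 then show ?thesis using far[of K "uminus ` K" z' 1 z] big ab by simp
    next
      case 2 then show ?thesis using far[of K "uminus ` K" z' 2 z] big ab by simp
    next
      case 3
      have "(of_int a, of_int b) \<in> I" using 3 by (auto simp: I_def)
      moreover have "z' = z + 2 *\<^sub>R \<mu> (of_int a, of_int b)"
        using zz by (simp add: \<mu>_def vector_3_scale algebra_simps)
      ultimately show ?thesis by (rule near)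
    qed
  qed
  have bal: "balanced I \<mu> \<nu>"
    unfolding balanced_def
  proof (intro conjI allI impI)
    have I: "I = {(1, 1), (1, -1), (-1, 1), (-1, -1)}" by (auto simp: I_def)
    show "finite I" by (simp add: I)
    show "(\<Sum>i\<in>I. \<nu> i) = 0" by (simp add: I \<nu>_def vec_eq_iff forall_3)
    show "v = 0" if "\<forall>i\<in>I. \<nu> i \<bullet> v = 0" for v
      using that by (simp add: I \<nu>_def inner_vector_3 vec_eq_iff forall_3)
    fix f :: "real^3 \<Rightarrow> real^3" assume "linear f \<and> (\<forall>x. f x \<bullet> x = 0)"
    then have lf: "linear f" and sf: "x \<bullet> f x = 0" for x by (auto simp: inner_commute)
    let ?e = "vector [0, 0, 1] :: real^3"
    \<comment> \<open>The part along \<open>\<mu> (s, t)\<close> has no moment. The vertical parts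
      have sign \<open>- (s * t)\<close>, equal at opposite contact points, where \<open>f\<close>
      takes opposite values, so they cancel in pairs.\<close>
    have "\<nu> (s, t) = (2 / r) *\<^sub>R \<mu> (s, t) + (- (s * t)) *\<^sub>R ?e" for s t
      using r by (simp add: \<nu>_def \<mu>_def vec_eq_iff forall_3)
    then have e: "\<nu> (s, t) \<bullet> f (\<mu> (s, t)) = - (s * t) * (?e \<bullet> f (\<mu> (s, t)))" for s t
      by (simp add: inner_add_left inner_diff_left sf)
    have "f (\<mu> (-1, -1)) = - f (\<mu> (1, 1))" "f (\<mu> (-1, 1)) = - f (\<mu> (1, -1))"
      by (simp_all add: \<mu>_def vector_3_uminus flip: linear_neg[OF lf])
    then have "\<nu> (-1, -1) \<bullet> f (\<mu> (-1, -1)) = ?e \<bullet> f (\<mu> (1, 1))"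
      "\<nu> (-1, 1) \<bullet> f (\<mu> (-1, 1)) = - (?e \<bullet> f (\<mu> (1, -1)))"
      using e[of "-1" "-1"] e[of "-1" 1] by simp_all
    moreover have "(\<Sum>i\<in>I. \<nu> i \<bullet> f (\<mu> i)) = \<nu> (1, 1) \<bullet> f (\<mu> (1, 1)) + \<nu> (1, -1) \<bullet> f (\<mu> (1, -1))
        + \<nu> (-1, 1) \<bullet> f (\<mu> (-1, 1)) + \<nu> (-1, -1) \<bullet> f (\<mu> (-1, -1))"
      by (simp add: I)
    ultimately show "(\<Sum>i\<in>I. \<nu> i \<bullet> f (\<mu> i)) = 0"
      using e[of 1 1] e[of 1 "-1"] by simp
  qed
  have lat: "vector [2 * r * of_int i, 2 * r * of_int j, 0] \<in> lattice2 u v" for i j :: int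
  proof -
    have "vector [2 * r * of_int i, 2 * r * of_int j, 0] = of_int i *\<^sub>R u + of_int j *\<^sub>R v"
      by (simp add: u_def v_def vec_eq_iff forall_3)
    then show ?thesis unfolding lattice2_def by blast
  qed
  have lat\<mu>: "2 *\<^sub>R \<mu> i - d \<in> lattice2 u v" if "i \<in> I" for i
  proof -
    obtain s t where i: "i = (s, t)" by (cases i)
    have "\<exists>p :: int. x - 1 = 2 * of_int p" if "x \<in> {1, -1 :: real}" for x
      using that by (auto intro: exI[of _ 0] exI[of _ "-1"])
    then obtain p q :: int where pq: "s - 1 = 2 * of_int p" "t - 1 = 2 * of_int q"
      using \<open>i \<in> I\<close> unfolding i I_def by blast
    have "2 *\<^sub>R \<mu> i - d = vector [r * (s - 1), r * (t - 1), 0]"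
      by (simp add: i \<mu>_def d_def vec_eq_iff forall_3 algebra_simps)
    also have "\<dots> = vector [2 * r * of_int p, 2 * r * of_int q, 0]" by (simp add: pq mult_ac)
    finally show ?thesis using lat by simp
  qed
  show ?thesis
  proof (rule interlocking_layer_exists[where F = "{K, K'}" and u = u and v = v])
    show "cross3 u v \<noteq> 0" using r by (simp add: u_def v_def cross3_def vec_eq_iff forall_3)
  next
    fix A assume "A \<in> {K, K'}"
    moreover have "polytope K"
      unfolding K_def std_tetrahedron_def by (intro polytope_scaling polytope_convex_hull) simp
    moreover from this have "polytope K'"
      by (simp add: K'_def polytope_translation_eq polytope_linear_image[OF linear_uminus])
    moreover have "congruent_sets T K" using T by (simp add: K_def)
    moreover from this have "congruent_sets T K'"
      unfolding K'_def by (intro congruent_sets_translate congruent_sets_uminus)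
    ultimately show "polytope A \<and> interior A \<noteq> {} \<and> congruent_sets T A" using intK intK' by blast
  next
    fix A B w assume AB: "A \<in> {K, K'}" "B \<in> {K, K'}" and "w \<in> lattice2 u v"
      and ne: "(\<lambda>x. w + x) ` B \<noteq> A"
    then obtain i j :: int where "w = of_int i *\<^sub>R u + of_int j *\<^sub>R v" by (auto simp: lattice2_def)
    then have w: "w = vector [2 * r * of_int i, 2 * r * of_int j, 0]"
      by (simp add: u_def v_def vec_eq_iff forall_3)
    have wK': "(\<lambda>x. w + x) ` K' = (\<lambda>x. (w + d) + x) ` uminus ` K"
      by (simp add: K'_def image_image add.assoc)
    have w0: "w \<noteq> 0" if "A = B" using ne that by auto
    consider "A = K" "B = K" | "A = K" "B = K'" | "A = K'" "B = K" | "A = K'" "B = K'" using AB by blast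
    then show "interior A \<inter> interior ((\<lambda>x. w + x) ` B) = {}"
    proof cases
      case 1
      then show ?thesis using same[of K w 0 i j] w w0 by simp
    next
      case 2
      have "(w + d) - 0 = vector [r * of_int (2 * i + 1), r * of_int (2 * j + 1), 0]"
        by (simp add: w d_def vec_eq_iff forall_3 algebra_simps)
      from opposite[OF this] show ?thesis using 2 by (simp add: wK')
    next
      case 3
      have "d - w = vector [r * of_int (1 - 2 * i), r * of_int (1 - 2 * j), 0]"
        by (simp add: w d_def vec_eq_iff forall_3 algebra_simps)
      from opposite[OF this] show ?thesis using 3 by (simp add: K'_def Int_commute)
    next
      case 4
      have "(w + d) - d = vector [2 * r * of_int i, 2 * r * of_int j, 0]" by (simp add: w)
      from same[of "uminus ` K", OF _ this] show ?thesis
        using 4 w0 by (simp only: wK') (simp add: K'_def)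
    qed
  next
    \<comment> \<open>Disjoint nonempty interiors supply the distinctness required of
      neighbours.\<close>
    have apart: "X \<noteq> Y" if "interior X \<inter> interior Y = {}" "interior X \<noteq> {}" for X Y :: "(real^3) set"
      using that by auto
    fix A assume A: "A \<in> {K, K'}"
    let ?contact = "\<lambda>m n i. facet_point A (m i) (n i) \<and> (\<exists>B\<in>{K, K'}. \<exists>w\<in>lattice2 u v.
         (\<lambda>x. w + x) ` B \<noteq> A \<and> facet_point ((\<lambda>x. w + x) ` B) (m i) (- n i))"
    have "\<exists>m n. balanced I m n \<and> (\<forall>i\<in>I. ?contact m n i)"
    proof (cases "A = K")
      case True
      have "?contact \<mu> \<nu> i" if i: "i \<in> I" for i
      proof -
        let ?w = "2 *\<^sub>R \<mu> i - d"
        have e: "(\<lambda>x. ?w + x) ` K' = (\<lambda>x. 2 *\<^sub>R \<mu> i + x) ` uminus ` K"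
          by (simp add: K'_def image_image)
        have "interior K \<inter> interior ((\<lambda>x. ?w + x) ` K') = {}"
          unfolding e using near[OF i, of "2 *\<^sub>R \<mu> i" 0] by simp
        then have "K \<noteq> (\<lambda>x. ?w + x) ` K'" using intK by (rule apart)
        moreover have "facet_point ((\<lambda>x. ?w + x) ` K') (\<mu> i) (- \<nu> i)"
          using facet_point_translate[OF facet'[OF i], of ?w] by (simp add: scaleR_2)
        ultimately show ?thesis using facet[OF i] lat\<mu>[OF i] True by blast
      qed
      then show ?thesis using bal by blast
    next
      case False
      then have AK': "A = K'" using A by simp
      let ?m = "\<lambda>i. d + - \<mu> i" and ?n = "\<lambda>i. - \<nu> i"
      have "?contact ?m ?n i" if i: "i \<in> I" for i
      proof -
        \<comment> \<open>The neighbours of \<open>K'\<close> are translates of \<open>K\<close> by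
          \<open>d - 2 *\<^sub>R \<mu> i\<close>, written as a difference from 0 to match
          \<open>lattice2_diff\<close>.\<close>
        let ?w = "0 - (2 *\<^sub>R \<mu> i - d)"
        have "interior ((\<lambda>x. ?w + x) ` K) \<inter> interior K' = {}"
          unfolding K'_def by (rule near[OF i]) simp
        then have "interior K' \<inter> interior ((\<lambda>x. ?w + x) ` K) = {}" by (subst Int_commute)
        then have "K' \<noteq> (\<lambda>x. ?w + x) ` K" using intK' by (rule apart)
        moreover have "facet_point ((\<lambda>x. ?w + x) ` K) (?m i) (- ?n i)"
          using facet_point_translate[OF facet[OF i], of ?w] by (simp add: scaleR_2)
        moreover have "?w \<in> lattice2 u v" by (rule lattice2_diff[OF lattice2_zero lat\<mu>[OF i]])
        ultimately show ?thesis using facet'[OF i] AK' by blast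
      qed
      moreover have "balanced I ?m ?n" by (rule balanced_translate[OF balanced_uminus[OF bal]])
      ultimately show ?thesis by (intro exI[of _ ?m] exI[of _ ?n]) blast
    qed
    then show "\<exists>(I :: (real \<times> real) set) m n. balanced I m n \<and> (\<forall>i\<in>I. ?contact m n i)" by blast
  qed simp_all
qed

theorem mainTheorem1:
  fixes T :: "(real^3) set"
  assumes "platonic_solid T"
  shows "\<exists>(n :: real^3) (a :: real) (b :: real) (L :: (real^3) set set).
           is_layer n a b L \<and> (\<forall>A\<in>L. congruent_sets T A) \<and> full_interlocking n a b L"
  using assms tetrahedron_layer cube_layer octahedron_layer dodecahedron_layer icosahedron_layer
  unfolding platonic_solid_def by blast

end
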